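(* Let $x\in[x_0,x_n]$. There exist indices $0\le i\le j\le n$ and a worst-case scenario $s$ for $x$ with $s\in S_{i,j}$ such that at least one of the following holds: (A) $\Theta(P,x:s)=\Theta_L(P,x:s)$ and either (A1) $\mathrm{LCV}(x:s)=j$, $x_j\le x_{OPT}(s)\le x$, $x_j<x$, and either (a) $i=j$ (so $s\in S_{j,j}$), or (b) $i<j$ and $w_j(s)=w_j^+$; or (A2) $\mathrm{LCV}(x:s)\ge j$ and $x_i\le x_{OPT}(s)\le x_j\le x$; (B) $\Theta(P,x:s)=\Theta_R(P,x:s)$ and either (B1) $\mathrm{RCV}(x:s)=i$, $x\le x_{OPT}(s)\le x_i$, $x<x_i$, and either (a) $i=j$ (so $s\in S_{i,i}$), or (b) $i<j$ and $w_i(s)=w_i^+$; or (B2) $\mathrm{RCV}(x:s)\le i$ and $x\le x_i\le x_{OPT}(s)\le x_j$.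
   Context: A path $P$ has vertices $v_0,\dots,v_n$ at positions $0=x_0<x_1<\dots<x_n$; edge $e_i=(v_i,v_{i+1})$ has length $x_{i+1}-x_i>0$ and capacity $c_i>0$. A scenario $s=(w_0(s),\dots,w_n(s))$ assigns nonnegative weights to the vertices; $W_{i,j}(s)=\sum_{t=i}^j w_t(s)$. For $x\le x'$ in $[x_0,x_n]$ let $d(x,x')=x'-x$ and $c(x,x')=\min\{c_t:i\le t<j\}$ with $i=\max\{i':x_{i'}\le x\}$, $j=\min\{j':x_{j'}\ge x'\}$. For $x_i<x$: $g_i(x:s)=d(x_i,x)+W_{0,i}(s)/c(x_i,x)$ if $W_{0,i}(s)>0$, else $0$; for $x_i>x$: $h_i(x:s)=d(x,x_i)+W_{i,n}(s)/c(x,x_i)$ if $W_{i,n}(s)>0$, else $0$. $\Theta_L(P,x:s)=\max_{i:x_i<x}g_i(x:s)$, $\Theta_R(P,x:s)=\max_{i:x_i>x}h_i(x:s)$ (empty maximum $=0$), $\Theta(P,x:s)=\max\{\Theta_L,\Theta_R\}$, $\Theta_{OPT}(P:s)=\min_{x\in[x_0,x_n]}\Theta(P,x:s)$; $x_{OPT}(s)$ denotes the (unique) point of $[x_0,x_n]$ at which $\Theta(P,\cdot:s)$ attains this minimum. $\mathrm{LCV}(x:s)=\arg\max_{i:x_i<x}g_i(x:s)$ and $\mathrm{RCV}(x:s)=\arg\max_{i:x_i>x}h_i(x:s)$, ties broken in favour of the maximizing index closest to $x$. Each vertex has a weight interval $[w_i^-,w_i^+]$, $0\le w_i^-\le w_i^+$;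 $\mathcal S=\prod_i[w_i^-,w_i^+]$. $R(P,x:s)=\Theta(P,x:s)-\Theta_{OPT}(P:s)$, $R_{\max}(P,x)=\max_{s\in\mathcal S}R(P,x:s)$; $s\in\mathcal S$ is a worst-case scenario for $x$ if $R(P,x:s)=R_{\max}(P,x)$. For $0\le i\le j\le n$ and $\alpha,\beta\ge0$, $s_{i,j}(\alpha,\beta)$ is the scenario with $w_t=w_t^-$ for $t<i$ or $t>j$, $w_t=w_t^+$ for $i<t<j$, $w_i=\alpha$, $w_j=\beta$ (if $i=j$ one requires $\alpha=\beta$); $S_{i,j}=\{s_{i,j}(\alpha,\beta):\alpha\in[w_i^-,w_i^+],\beta\in[w_j^-,w_j^+]\}$. *)

theory Defs
  imports Complex_Main "HOL-Library.FuncSet"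
begin

text \<open>
  A path has vertices \<open>0, ..., last_vertex P\<close> on the real line and edges
  \<open>0, ..., last_vertex P - 1\<close>, edge \<open>t\<close> joining the vertices \<open>t\<close> and \<open>t + 1\<close>.
  The values of \<open>pos P\<close> and \<open>cap P\<close> at larger indices are irrelevant.
\<close>

record path_network =
  last_vertex :: nat
  pos :: "nat \<Rightarrow> real"
  cap :: "nat \<Rightarrow> real"

definition path_network :: "path_network \<Rightarrow> bool" where
  "path_network P \<longleftrightarrow>
     last_vertex P \<ge> 1 \<and> pos P 0 = 0 \<and>
     (\<forall>i<last_vertex P. pos P i < pos P (Suc i)) \<and>
     (\<forall>i<last_vertex P. cap P i > 0)"

definition points :: "path_network \<Rightarrow> real set" where
  "points P = {pos P 0..pos P (last_vertex P)}"

type_synonym scenario = "nat \<Rightarrow> real"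

definition W :: "scenario \<Rightarrow> nat \<Rightarrow> nat \<Rightarrow> real" where
  "W s i j = (\<Sum>t=i..j. s t)"

text \<open>Meaningful for \<open>x < x'\<close> in \<open>points P\<close>; the minimum is then over a nonempty set.\<close>

definition cap_between :: "path_network \<Rightarrow> real \<Rightarrow> real \<Rightarrow> real" where
  "cap_between P x x' =
     (let i = Max {k. k \<le> last_vertex P \<and> pos P k \<le> x};
          j = Min {k. k \<le> last_vertex P \<and> x' \<le> pos P k}
      in Min (cap P ` {i..<j}))"

definition g :: "path_network \<Rightarrow> scenario \<Rightarrow> real \<Rightarrow> nat \<Rightarrow> real" where
  "g P s x i =
     (if W s 0 i > 0 then (x - pos P i) + W s 0 i / cap_between P (pos P i) x else 0)"

definition h :: "path_network \<Rightarrow> scenario \<Rightarrow> real \<Rightarrow> nat \<Rightarrow> real" where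
  "h P s x i =
     (if W s i (last_vertex P) > 0
      then (pos P i - x) + W s i (last_vertex P) / cap_between P x (pos P i) else 0)"

definition left_vertices :: "path_network \<Rightarrow> real \<Rightarrow> nat set" where
  "left_vertices P x = {i. i \<le> last_vertex P \<and> pos P i < x}"

definition right_vertices :: "path_network \<Rightarrow> real \<Rightarrow> nat set" where
  "right_vertices P x = {i. i \<le> last_vertex P \<and> x < pos P i}"

definition Theta_L :: "path_network \<Rightarrow> real \<Rightarrow> scenario \<Rightarrow> real" where
  "Theta_L P x s =
     (if left_vertices P x = {} then 0 else Max (g P s x ` left_vertices P x))"

definition Theta_R :: "path_network \<Rightarrow> real \<Rightarrow> scenario \<Rightarrow> real" where
  "Theta_R P x s =
     (if right_vertices P x = {} then 0 else Max (h P s x ` right_vertices P x))"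

definition Theta :: "path_network \<Rightarrow> real \<Rightarrow> scenario \<Rightarrow> real" where
  "Theta P x s = max (Theta_L P x s) (Theta_R P x s)"

text \<open>
  For nonnegative weights the infimum is attained, because \<open>Theta_L\<close> is nondecreasing and
  left-continuous in \<open>x\<close> and \<open>Theta_R\<close> is nonincreasing and right-continuous.
  The minimizer is unique unless all weights vanish; in that case \<open>Theta\<close> is identically \<open>0\<close>
  and \<open>x_OPT\<close> is an arbitrary, unspecified point of the path.
\<close>

definition Theta_OPT :: "path_network \<Rightarrow> scenario \<Rightarrow> real" where
  "Theta_OPT P s = (INF x\<in>points P. Theta P x s)"

definition x_OPT :: "path_network \<Rightarrow> scenario \<Rightarrow> real" where
  "x_OPT P s = (SOME x. x \<in> points P \<and> Theta P x s = Theta_OPT P s)"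

text \<open>
  The critical vertices are undefined (\<open>None\<close>) when there is no vertex on the relevant side
  of \<open>x\<close>. Among the maximizers, the one closest to \<open>x\<close> has the largest index on the left
  and the smallest index on the right.
\<close>

definition LCV :: "path_network \<Rightarrow> real \<Rightarrow> scenario \<Rightarrow> nat option" where
  "LCV P x s =
     (if left_vertices P x = {} then None
      else Some (Max {i. is_arg_max (g P s x) (\<lambda>k. k \<in> left_vertices P x) i}))"

definition RCV :: "path_network \<Rightarrow> real \<Rightarrow> scenario \<Rightarrow> nat option" where
  "RCV P x s =
     (if right_vertices P x = {} then None
      else Some (Min {i. is_arg_max (h P s x) (\<lambda>k. k \<in> right_vertices P x) i}))"

definition weight_intervals ::
  "path_network \<Rightarrow> (nat \<Rightarrow> real) \<Rightarrow> (nat \<Rightarrow> real) \<Rightarrow> bool" where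
  "weight_intervals P wl wu \<longleftrightarrow> (\<forall>i\<le>last_vertex P. 0 \<le> wl i \<and> wl i \<le> wu i)"

definition scenarios ::
  "path_network \<Rightarrow> (nat \<Rightarrow> real) \<Rightarrow> (nat \<Rightarrow> real) \<Rightarrow> scenario set" where
  "scenarios P wl wu = (\<Pi>\<^sub>E i\<in>{..last_vertex P}. {wl i..wu i})"

definition regret :: "path_network \<Rightarrow> real \<Rightarrow> scenario \<Rightarrow> real" where
  "regret P x s = Theta P x s - Theta_OPT P s"

definition max_regret ::
  "path_network \<Rightarrow> (nat \<Rightarrow> real) \<Rightarrow> (nat \<Rightarrow> real) \<Rightarrow> real \<Rightarrow> real" where
  "max_regret P wl wu x = (SUP s\<in>scenarios P wl wu. regret P x s)"

definition worst_case ::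
  "path_network \<Rightarrow> (nat \<Rightarrow> real) \<Rightarrow> (nat \<Rightarrow> real) \<Rightarrow> real \<Rightarrow> scenario \<Rightarrow> bool" where
  "worst_case P wl wu x s \<longleftrightarrow>
     s \<in> scenarios P wl wu \<and> regret P x s = max_regret P wl wu x"

text \<open>Meaningful only if \<open>i \<le> j\<close>, and \<open>\<alpha> = \<beta>\<close> in case \<open>i = j\<close>.\<close>

definition s_ij ::
  "path_network \<Rightarrow> (nat \<Rightarrow> real) \<Rightarrow> (nat \<Rightarrow> real) \<Rightarrow> nat \<Rightarrow> nat \<Rightarrow> real \<Rightarrow> real \<Rightarrow> scenario" where
  "s_ij P wl wu i j \<alpha> \<beta> =
     (\<lambda>t\<in>{..last_vertex P}.
        if t < i \<or> j < t then wl t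
        else if t = i then \<alpha>
        else if t = j then \<beta>
        else wu t)"

definition S_ij ::
  "path_network \<Rightarrow> (nat \<Rightarrow> real) \<Rightarrow> (nat \<Rightarrow> real) \<Rightarrow> nat \<Rightarrow> nat \<Rightarrow> scenario set" where
  "S_ij P wl wu i j =
     {s_ij P wl wu i j \<alpha> \<beta> | \<alpha> \<beta>.
        \<alpha> \<in> {wl i..wu i} \<and> \<beta> \<in> {wl j..wu j} \<and> (i = j \<longrightarrow> \<alpha> = \<beta>)}"

end

theory Submission
  imports Defs
begin

text \<open>
  Let \<open>s\<close> be a worst-case scenario with positive regret and \<open>Theta P x s = Theta_L P x s\<close>; put
  \<open>l = LCV\<close> and \<open>y = x_OPT\<close>, so that \<open>y < x\<close>. Keep the total weight of the vertices \<open>0, \<dots>, l\<close>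
  (which fixes \<open>g\<close> at \<open>l\<close>), lower everything after \<open>l\<close>, and push the weight on either side of
  \<open>min y (pos P l)\<close> towards that point as far as the intervals allow. Then the evacuation time at \<open>y\<close>
  does not increase, so neither does the optimum, and the regret at \<open>x\<close> does not drop. As \<open>s\<close> was a
  worst case, nothing changes: \<open>y\<close> is still the optimum and \<open>l\<close> still a maximizer. The new
  scenario has the required shape. The case of \<open>Theta_R\<close> follows by reflecting the path.

  That a worst case exists is not plain compactness, because \<open>g\<close> jumps down to \<open>0\<close> when the
  weight \<open>W s 0 l\<close> vanishes. Scenarios with \<open>W s 0 l\<close> bounded away from \<open>0\<close> are handled by
  compactness; those with small \<open>W s 0 l\<close> are dominated by one explicit scenario. If
  the maximal regret is \<open>0\<close>, then the scenario of lower bounds is a worst case.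
\<close>

section \<open>Path geometry and capacities\<close>

locale network =
  fixes P :: path_network
  assumes network: "path_network P"
begin

abbreviation N :: nat where "N \<equiv> last_vertex P"

lemma pos_less: "i < j \<Longrightarrow> j \<le> N \<Longrightarrow> pos P i < pos P j"
proof (induction j)
  case (Suc j)
  have "pos P j < pos P (Suc j)"
    using network Suc.prems by (auto simp: path_network_def)
  then show ?case using Suc by (cases "i = j") auto
qed simp

lemma pos_less_iff: "i \<le> N \<Longrightarrow> j \<le> N \<Longrightarrow> pos P i < pos P j \<longleftrightarrow> i < j"
  by (metis less_asym linorder_neqE_nat pos_less order_less_irrefl)

lemma pos_le_iff: "i \<le> N \<Longrightarrow> j \<le> N \<Longrightarrow> pos P i \<le> pos P j \<longleftrightarrow> i \<le> j"
  using pos_less_iff[of j i] by auto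

lemma pos_in_points: "i \<le> N \<Longrightarrow> pos P i \<in> points P"
  by (simp add: points_def pos_le_iff)

lemma cap_pos: "t < N \<Longrightarrow> 0 < cap P t"
  using network by (simp add: path_network_def)

text \<open>The edges whose interior meets the open interval from \<open>u\<close> to
  \<open>v\<close> (for \<open>u < v\<close>). Unlike the index range in \<open>cap_between\<close>,
  this description is visibly monotone in the interval and symmetric under reflection.\<close>

definition edges :: "real \<Rightarrow> real \<Rightarrow> nat set" where
  "edges u v = {t. t < N \<and> pos P t < v \<and> u < pos P (Suc t)}"

lemma finite_edges [simp]: "finite (edges u v)"
  by (simp add: edges_def)

text \<open>With \<open>i\<close> the last vertex at or before \<open>u\<close> and \<open>j\<close>
  the first at or after \<open>v\<close>, edge \<open>t\<close> misses the open interval exactly if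
  its right end has index at most \<open>i\<close> or its left end has index at least
  \<open>j\<close>.\<close>

lemma cap_between_eq:
  assumes "u \<in> points P" "v \<in> points P" "u < v"
  shows "cap_between P u v = Min (cap P ` edges u v)" "edges u v \<noteq> {}"
proof -
  let ?I = "{k. k \<le> N \<and> pos P k \<le> u}" and ?J = "{k. k \<le> N \<and> v \<le> pos P k}"
  define i j where "i = Max ?I" and "j = Min ?J"
  have "0 \<in> ?I" "N \<in> ?J" using assms by (auto simp: points_def)
  then have "?I \<noteq> {}" "?J \<noteq> {}" by blast+
  then have i: "i \<in> ?I" and j: "j \<in> ?J"
    unfolding i_def j_def by (metis (lifting) Max_in Min_in finite_nat_set_iff_bounded_le mem_Collect_eq)+
  have Imax: "k \<le> i" if "k \<in> ?I" for k unfolding i_def using that by (intro Max_ge) auto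
  have Jmin: "j \<le> k" if "k \<in> ?J" for k unfolding j_def using that by (intro Min_le) auto
  have "i < j" using i j assms pos_less_iff[of i j] by auto
  have *: "{i..<j} = edges u v"
  proof (intro set_eqI iffI)
    fix t assume t: "t \<in> {i..<j}"
    then have "\<not> Suc t \<le> i" "\<not> j \<le> t" "t < N" using j by auto
    then show "t \<in> edges u v"
      using Imax[of "Suc t"] Jmin[of t] by (auto simp: edges_def not_le[symmetric])
  next
    fix t assume t: "t \<in> edges u v"
    then have "\<not> Suc t \<le> i" "\<not> j \<le> t"
      using i j pos_le_iff[of "Suc t" i] pos_le_iff[of j t] by (auto simp: edges_def)
    then show "t \<in> {i..<j}" by auto
  qed
  show "cap_between P u v = Min (cap P ` edges u v)"
    unfolding cap_between_def Let_def i_def[symmetric] j_def[symmetric] * ..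
  show "edges u v \<noteq> {}" using * \<open>i < j\<close> by auto
qed

lemma cap_between_pos:
  assumes "u \<in> points P" "v \<in> points P" "u < v"
  shows "0 < cap_between P u v"
proof -
  have "cap P t > 0" if "t \<in> edges u v" for t
    using that by (simp add: edges_def cap_pos)
  then show ?thesis using cap_between_eq[OF assms] by (simp add: Min_gr_iff)
qed

lemma cap_between_antimono:
  assumes "u' \<in> points P" "v' \<in> points P" "u' \<le> u" "u < v" "v \<le> v'"
  shows "cap_between P u' v' \<le> cap_between P u v"
proof -
  have "u \<in> points P" "v \<in> points P" using assms by (auto simp: points_def)
  moreover have "edges u v \<subseteq> edges u' v'" using assms by (auto simp: edges_def)
  ultimately show ?thesis
    using assms by (auto simp: cap_between_eq intro!: Min_antimono)
qed

text \<open>The capacity across the whole path: a positive lower bound for every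
  \<open>cap_between\<close>, which makes estimates uniform in the point and the vertex.\<close>

definition cap_min :: real where "cap_min = cap_between P (pos P 0) (pos P N)"

lemma cap_min_pos: "0 < cap_min"
  using network pos_less[of 0 N] unfolding cap_min_def path_network_def
  by (intro cap_between_pos pos_in_points) auto

lemma cap_min_le: "u \<in> points P \<Longrightarrow> v \<in> points P \<Longrightarrow> u < v \<Longrightarrow> cap_min \<le> cap_between P u v"
  unfolding cap_min_def by (rule cap_between_antimono) (auto simp: points_def)

lemma finite_left_vertices [simp]: "finite (left_vertices P y)"
  and finite_right_vertices [simp]: "finite (right_vertices P y)"
  by (simp_all add: left_vertices_def right_vertices_def)

section \<open>Weights and evacuation times on the left side\<close>

definition nonneg :: "scenario \<Rightarrow> bool" where "nonneg s \<longleftrightarrow> (\<forall>i\<le>N. 0 \<le> s i)"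

lemma W_nonneg: "nonneg s \<Longrightarrow> j \<le> N \<Longrightarrow> 0 \<le> W s i j"
  by (auto simp: W_def nonneg_def intro!: sum_nonneg)

lemma W_ge: "nonneg s \<Longrightarrow> i \<le> t \<Longrightarrow> t \<le> j \<Longrightarrow> j \<le> N \<Longrightarrow> s t \<le> W s i j"
  unfolding W_def by (rule member_le_sum) (auto simp: nonneg_def)

lemma W_pos_ex: "0 < W s i j \<Longrightarrow> \<exists>t\<in>{i..j}. 0 < s t"
  unfolding W_def by (metis not_le sum_nonpos)

text \<open>Moving right, the distance grows at rate one and the bottleneck capacity can only
  shrink. This slope of at least one is what later makes the optimum unique.\<close>

lemma g_increase:
  assumes "i \<le> N" "pos P i < y" "y \<le> y'" "y' \<in> points P" "0 < W s 0 i"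
  shows "g P s y i + (y' - y) \<le> g P s y' i"
proof -
  have y: "y \<in> points P" "pos P i \<in> points P" using assms pos_in_points[of i] by (auto simp: points_def)
  have "cap_between P (pos P i) y' \<le> cap_between P (pos P i) y"
    using assms y by (intro cap_between_antimono) auto
  then have "W s 0 i / cap_between P (pos P i) y \<le> W s 0 i / cap_between P (pos P i) y'"
    using assms y by (intro divide_left_mono mult_pos_pos cap_between_pos) auto
  then show ?thesis using assms(5) by (simp add: g_def)
qed

lemma g_pos:
  assumes "i \<le> N" "pos P i < y" "y \<in> points P" "0 < W s 0 i"
  shows "0 < g P s y i"
  using assms cap_between_pos[of "pos P i" y] pos_in_points[of i]
  by (simp add: g_def add_pos_pos)

lemma g_nonneg: "i \<le> N \<Longrightarrow> pos P i < y \<Longrightarrow> y \<in> points P \<Longrightarrow> 0 \<le> g P s y i"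
  using g_pos[of i y s] by (cases "0 < W s 0 i") (auto simp: g_def)

lemma Theta_L_ge: "i \<in> left_vertices P y \<Longrightarrow> g P s y i \<le> Theta_L P y s"
  by (auto simp: Theta_L_def)

lemma Theta_L_attained:
  assumes "left_vertices P y \<noteq> {}"
  obtains i where "i \<in> left_vertices P y" "Theta_L P y s = g P s y i"
proof -
  have "Max (g P s y ` left_vertices P y) \<in> g P s y ` left_vertices P y"
    using assms by (intro Max_in) auto
  then obtain i where "i \<in> left_vertices P y" "Max (g P s y ` left_vertices P y) = g P s y i"
    by blast
  then show ?thesis using that assms by (simp add: Theta_L_def)
qed

lemma Theta_L_nonneg:
  assumes "y \<in> points P"
  shows "0 \<le> Theta_L P y s"
proof (cases "left_vertices P y = {}")
  case False
  then obtain i where "i \<in> left_vertices P y" "Theta_L P y s = g P s y i"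
    by (rule Theta_L_attained)
  then show ?thesis using g_nonneg assms by (auto simp: left_vertices_def)
qed (simp add: Theta_L_def)

lemma Theta_L_le:
  assumes "0 \<le> b" "\<And>i. i \<in> left_vertices P y \<Longrightarrow> g P s y i \<le> b"
  shows "Theta_L P y s \<le> b"
  using assms by (auto simp: Theta_L_def)

lemma Theta_L_posE:
  assumes "0 < Theta_L P y s"
  obtains i where "i \<le> N" "pos P i < y" "Theta_L P y s = g P s y i" "0 < W s 0 i"
proof -
  have "left_vertices P y \<noteq> {}" using assms by (auto simp: Theta_L_def)
  then obtain i where "i \<in> left_vertices P y" "Theta_L P y s = g P s y i"
    by (rule Theta_L_attained)
  moreover from this have "0 < W s 0 i" using assms by (auto simp: g_def split: if_splits)
  ultimately show ?thesis using that by (auto simp: left_vertices_def)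
qed

lemma Theta_L_increase:
  assumes "0 < Theta_L P y s" "y \<le> y'" "y' \<in> points P"
  shows "Theta_L P y s + (y' - y) \<le> Theta_L P y' s"
proof -
  from assms(1) obtain i where i: "i \<le> N" "pos P i < y" "Theta_L P y s = g P s y i" "0 < W s 0 i"
    by (rule Theta_L_posE)
  then have "g P s y i + (y' - y) \<le> g P s y' i" using assms by (intro g_increase) auto
  moreover have "g P s y' i \<le> Theta_L P y' s"
    using i assms by (intro Theta_L_ge) (auto simp: left_vertices_def)
  ultimately show ?thesis using i by simp
qed

lemma Theta_L_mono:
  assumes "y \<le> y'" "y' \<in> points P"
  shows "Theta_L P y s \<le> Theta_L P y' s"
  using Theta_L_increase[of y s y'] Theta_L_nonneg[of y' s] assms by fastforce

text \<open>Let \<open>z\<close> be the position of the last vertex before \<open>y\<close>. Between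
  \<open>z\<close> and \<open>y\<close> neither the set of left vertices nor the edges that have to
  be crossed change, so each \<open>g\<close> varies only through its distance term.\<close>

lemma Theta_L_left_cont:
  assumes "y \<in> points P" "pos P 0 < y"
  shows "\<exists>z<y. \<forall>y'. z < y' \<and> y' \<le> y \<longrightarrow> Theta_L P y s \<le> Theta_L P y' s + (y - y')"
proof -
  have "0 \<in> left_vertices P y" using assms by (simp add: left_vertices_def)
  then have ne: "left_vertices P y \<noteq> {}" by auto
  define z where "z = Max (pos P ` left_vertices P y)"
  have "z \<in> pos P ` left_vertices P y" unfolding z_def using ne by (intro Max_in) auto
  then have z: "z < y" "pos P 0 \<le> z" by (auto simp: left_vertices_def pos_le_iff)
  have zmax: "pos P i \<le> z" if "i \<le> N" "pos P i < y" for i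
    unfolding z_def using that by (intro Max_ge) (auto simp: left_vertices_def)
  have "Theta_L P y s \<le> Theta_L P y' s + (y - y')" if y': "z < y'" "y' \<le> y" for y'
  proof -
    obtain i where i: "i \<in> left_vertices P y" "Theta_L P y s = g P s y i"
      using ne by (rule Theta_L_attained)
    have iN: "i \<le> N" "pos P i < y'" "pos P i < y" using i zmax[of i] y' by (auto simp: left_vertices_def)
    have y'p: "y' \<in> points P" using y' z assms by (auto simp: points_def)
    have "pos P t < y' \<longleftrightarrow> pos P t < y" if "t < N" for t
      using y' zmax[of t] that by auto
    then have "edges (pos P i) y' = edges (pos P i) y"
      by (auto simp: edges_def)
    then have "cap_between P (pos P i) y' = cap_between P (pos P i) y"
      using iN y'p assms pos_in_points[of i] by (simp add: cap_between_eq)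
    then have "g P s y i \<le> g P s y' i + (y - y')" using y' by (simp add: g_def)
    moreover have "g P s y' i \<le> Theta_L P y' s"
      using iN by (intro Theta_L_ge) (auto simp: left_vertices_def)
    ultimately show ?thesis using i by simp
  qed
  then show ?thesis using z by blast
qed

text \<open>An excess weight of at most \<open>d\<close>, sent through capacity at least
  \<open>C\<close>, costs at most \<open>d / C\<close> in time. Requiring positivity to pass from
  \<open>s\<close> to \<open>s'\<close> copes with the jump of \<open>g\<close> at weight 0. The
  choices of \<open>d\<close> give monotonicity in the weights, semicontinuity and the effect of
  added weight.\<close>

lemma Theta_L_compare:
  assumes "y \<in> points P" "0 \<le> d" "0 < C"
    and "\<And>i. i \<le> N \<Longrightarrow> pos P i < y \<Longrightarrow> 0 < W s 0 i \<Longrightarrow>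
      0 < W s' 0 i \<and> W s 0 i \<le> W s' 0 i + d \<and> C \<le> cap_between P (pos P i) y"
  shows "Theta_L P y s \<le> Theta_L P y s' + d / C"
proof (rule Theta_L_le)
  show nn: "0 \<le> Theta_L P y s' + d / C" using assms Theta_L_nonneg[of y s'] by simp
  fix i assume i: "i \<in> left_vertices P y"
  then have iN: "i \<le> N" "pos P i < y" by (auto simp: left_vertices_def)
  show "g P s y i \<le> Theta_L P y s' + d / C"
  proof (cases "0 < W s 0 i")
    case True
    note c = assms(4)[OF iN True]
    have "W s 0 i / cap_between P (pos P i) y \<le> (W s' 0 i + d) / cap_between P (pos P i) y"
      using c assms by (intro divide_right_mono) auto
    moreover have "d / cap_between P (pos P i) y \<le> d / C"
      using c assms by (intro divide_left_mono) auto
    ultimately have "g P s y i \<le> g P s' y i + d / C"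
      using True c by (simp add: g_def add_divide_distrib)
    then show ?thesis using Theta_L_ge[OF i, of s'] by simp
  qed (use nn in \<open>simp add: g_def\<close>)
qed

lemma Theta_L_compare0:
  assumes "y \<in> points P" "\<And>i. i \<le> N \<Longrightarrow> pos P i < y \<Longrightarrow> W s 0 i \<le> W s' 0 i"
  shows "Theta_L P y s \<le> Theta_L P y s'"
  using Theta_L_compare[of y 0 cap_min s s'] assms cap_min_pos
  by (fastforce intro: cap_min_le pos_in_points)

lemma LCV_iff:
  "LCV P y s = Some l \<longleftrightarrow>
    l \<in> left_vertices P y \<and> Theta_L P y s = g P s y l \<and>
    (\<forall>t\<in>left_vertices P y. l < t \<longrightarrow> g P s y t < g P s y l)" (is "_ \<longleftrightarrow> ?R")
proof (cases "left_vertices P y = {}")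
  case False
  let ?A = "{i. is_arg_max (g P s y) (\<lambda>k. k \<in> left_vertices P y) i}"
  have A: "?A = {i \<in> left_vertices P y. g P s y i = Theta_L P y s}"
  proof -
    obtain i where i: "i \<in> left_vertices P y" "Theta_L P y s = g P s y i"
      using Theta_L_attained[OF False] .
    show ?thesis
      using i Theta_L_ge[of _ y s] by (auto simp: is_arg_max_def not_less intro!: antisym)
  qed
  obtain i where "i \<in> left_vertices P y" "Theta_L P y s = g P s y i"
    using Theta_L_attained[OF False] .
  then have "finite ?A" "?A \<noteq> {}" unfolding A by auto
  then have "Max ?A = l \<longleftrightarrow> l \<in> ?A \<and> (\<forall>a\<in>?A. a \<le> l)"
    by (rule Max_eq_iff)
  also have "\<dots> \<longleftrightarrow> ?R"
  proof -
    have "(t \<le> l \<or> g P s y t \<noteq> Theta_L P y s) \<longleftrightarrow> (l < t \<longrightarrow> g P s y t < Theta_L P y s)"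
      if "t \<in> left_vertices P y" for t
      using Theta_L_ge[OF that, of s] by auto
    then show ?thesis unfolding A by fastforce
  qed
  finally show ?thesis using False by (simp add: LCV_def)
qed (simp add: LCV_def)

lemma LCV_exists:
  assumes "left_vertices P y \<noteq> {}"
  obtains l where "LCV P y s = Some l"
  using assms by (simp add: LCV_def)

end

section \<open>Reflection of a path\<close>

text \<open>Reflection sends the coordinate \<open>y\<close> to the path length minus
  \<open>y\<close> and vertex \<open>i\<close> to \<open>n - i\<close>. Edge \<open>t\<close> joins
  \<open>t\<close> and \<open>t + 1\<close>, hence the shift by one in its image
  \<open>n - Suc t\<close>. The restriction in \<open>mirror_w\<close> keeps scenarios extensional,
  so that reflecting a scenario twice gives it back.\<close>

definition mirror :: "path_network \<Rightarrow> path_network" where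
  "mirror P =
     (let n = last_vertex P
      in \<lparr>last_vertex = n, pos = (\<lambda>i. pos P n - pos P (n - i)), cap = (\<lambda>t. cap P (n - Suc t))\<rparr>)"

definition mirror_w :: "path_network \<Rightarrow> scenario \<Rightarrow> scenario" where
  "mirror_w P s = (\<lambda>i\<in>{..last_vertex P}. s (last_vertex P - i))"

context network
begin

abbreviation L :: real where "L \<equiv> pos P N"

lemma pos_0: "pos P 0 = 0"
  using network by (simp add: path_network_def)

lemma last_vertex_mirror [simp]: "last_vertex (mirror P) = N"
  by (simp add: mirror_def Let_def)

lemma pos_mirror: "pos (mirror P) i = L - pos P (N - i)"
  by (simp add: mirror_def Let_def)

lemma cap_mirror: "cap (mirror P) t = cap P (N - Suc t)"
  by (simp add: mirror_def Let_def)

lemma network_mirror: "network (mirror P)"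
proof
  show "path_network (mirror P)"
    using network pos_0 unfolding path_network_def
    by (auto simp: pos_mirror cap_mirror intro!: pos_less)
qed

lemma points_mirror [simp]: "points (mirror P) = points P"
  by (simp add: points_def pos_mirror pos_0)

lemma reflect_in_points [simp]: "L - y \<in> points P \<longleftrightarrow> y \<in> points P"
  by (auto simp: points_def pos_0)

lemma W_mirror:
  assumes "i \<le> N" "j \<le> N"
  shows "W (mirror_w P s) (N - j) (N - i) = W s i j"
  unfolding W_def
  by (rule sum.reindex_bij_witness[where i = "\<lambda>t. N - t" and j = "\<lambda>t. N - t"])
     (use assms in \<open>auto simp: mirror_w_def\<close>)

lemma edges_mirror:
  "network.edges (mirror P) (L - v) (L - u) = (\<lambda>t. N - Suc t) ` edges u v" (is "?A = ?f ` ?B")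
proof (intro set_eqI iffI)
  fix t assume t: "t \<in> ?A"
  then have "t < N" by (simp add: network.edges_def[OF network_mirror])
  then have "t = ?f (?f t)" "N - t = Suc (?f t)" by auto
  moreover have "?f t \<in> ?B"
    using t \<open>N - t = Suc (?f t)\<close>
    by (auto simp: network.edges_def[OF network_mirror] edges_def pos_mirror)
  ultimately show "t \<in> ?f ` ?B" by blast
next
  fix t assume "t \<in> ?f ` ?B"
  then obtain t' where t': "t = ?f t'" "t' \<in> ?B" by blast
  then have "t' < N" by (simp add: edges_def)
  then have "N - t = Suc t'" "N - Suc t = t'" "t < N" using t' by auto
  then show "t \<in> ?A"
    using t' by (simp add: network.edges_def[OF network_mirror] edges_def pos_mirror)
qed

lemma cap_between_mirror:
  assumes "u \<in> points P" "v \<in> points P" "u < v"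
  shows "cap_between (mirror P) (L - v) (L - u) = cap_between P u v"
proof -
  have "cap (mirror P) ` network.edges (mirror P) (L - v) (L - u) = cap P ` edges u v"
    unfolding edges_mirror image_image by (rule image_cong) (auto simp: cap_mirror edges_def)
  then show ?thesis
    using assms cap_between_eq(1)[OF assms]
      network.cap_between_eq(1)[OF network_mirror, of "L - v" "L - u"] by simp
qed

lemma g_mirror:
  assumes "i \<le> N" "y < pos P i" "y \<in> points P"
  shows "g (mirror P) (mirror_w P s) (L - y) (N - i) = h P s y i"
  using assms cap_between_mirror[of y "pos P i"] W_mirror[of i N s] pos_in_points[of i]
  by (simp add: g_def h_def pos_mirror)

lemma h_mirror:
  assumes "i \<le> N" "pos P i < y" "y \<in> points P"
  shows "h (mirror P) (mirror_w P s) (L - y) (N - i) = g P s y i"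
  using assms cap_between_mirror[of "pos P i" y] W_mirror[of 0 i s] pos_in_points[of i]
  by (simp add: g_def h_def pos_mirror)

lemma left_vertices_mirror:
  "left_vertices (mirror P) (L - y) = (\<lambda>i. N - i) ` right_vertices P y" (is "?A = ?f ` ?B")
proof (intro subset_antisym subsetI)
  fix i assume "i \<in> ?A"
  then have "i = ?f (?f i)" "?f i \<in> ?B"
    by (auto simp: left_vertices_def right_vertices_def pos_mirror)
  then show "i \<in> ?f ` ?B" by (rule image_eqI)
qed (auto simp: left_vertices_def right_vertices_def pos_mirror)

lemma right_vertices_mirror:
  "right_vertices (mirror P) (L - y) = (\<lambda>i. N - i) ` left_vertices P y" (is "?A = ?f ` ?B")
proof (intro subset_antisym subsetI)
  fix i assume "i \<in> ?A"
  then have "i = ?f (?f i)" "?f i \<in> ?B"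
    by (auto simp: left_vertices_def right_vertices_def pos_mirror)
  then show "i \<in> ?f ` ?B" by (rule image_eqI)
qed (auto simp: left_vertices_def right_vertices_def pos_mirror)

lemma Theta_L_mirror:
  assumes "y \<in> points P"
  shows "Theta_L (mirror P) (L - y) (mirror_w P s) = Theta_R P y s"
proof -
  have "g (mirror P) (mirror_w P s) (L - y) ` left_vertices (mirror P) (L - y) =
    h P s y ` right_vertices P y"
    unfolding left_vertices_mirror image_image
    using assms by (intro image_cong g_mirror) (auto simp: right_vertices_def)
  then show ?thesis unfolding Theta_L_def Theta_R_def by (simp add: left_vertices_mirror)
qed

lemma Theta_R_mirror:
  assumes "y \<in> points P"
  shows "Theta_R (mirror P) (L - y) (mirror_w P s) = Theta_L P y s"
proof -
  have "h (mirror P) (mirror_w P s) (L - y) ` right_vertices (mirror P) (L - y) =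
    g P s y ` left_vertices P y"
    unfolding right_vertices_mirror image_image
    using assms by (intro image_cong h_mirror) (auto simp: left_vertices_def)
  then show ?thesis unfolding Theta_L_def Theta_R_def by (simp add: right_vertices_mirror)
qed

lemma Theta_mirror:
  "y \<in> points P \<Longrightarrow> Theta (mirror P) (L - y) (mirror_w P s) = Theta P y s"
  by (simp add: Theta_def Theta_L_mirror Theta_R_mirror max.commute)

lemma Theta_OPT_mirror: "Theta_OPT (mirror P) (mirror_w P s) = Theta_OPT P s"
proof -
  have "(\<lambda>y. Theta (mirror P) y (mirror_w P s)) ` points P = (\<lambda>y. Theta P y s) ` points P"
  proof (intro subset_antisym image_subsetI)
    fix y assume "y \<in> points P"
    then have "Theta (mirror P) y (mirror_w P s) = Theta P (L - y) s"
      using Theta_mirror[of "L - y" s] by simp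
    then show "Theta (mirror P) y (mirror_w P s) \<in> (\<lambda>y. Theta P y s) ` points P"
      using \<open>y \<in> points P\<close> by simp
  next
    fix y assume "y \<in> points P"
    then show "Theta P y s \<in> (\<lambda>y. Theta (mirror P) y (mirror_w P s)) ` points P"
      by (intro image_eqI[of _ _ "L - y"]) (simp_all add: Theta_mirror)
  qed
  then show ?thesis by (simp add: Theta_OPT_def)
qed

lemma regret_mirror:
  "y \<in> points P \<Longrightarrow> regret (mirror P) (L - y) (mirror_w P s) = regret P y s"
  by (simp add: regret_def Theta_mirror Theta_OPT_mirror)

section \<open>Facts about the right side, mostly obtained by reflection\<close>

lemma Theta_R_ge:
  assumes "i \<in> right_vertices P y"
  shows "h P s y i \<le> Theta_R P y s"
  using assms by (auto simp: Theta_R_def)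

lemma Theta_R_nonneg: "y \<in> points P \<Longrightarrow> 0 \<le> Theta_R P y s"
  using network.Theta_L_nonneg[OF network_mirror, of "L - y" "mirror_w P s"]
  by (simp add: Theta_L_mirror)

lemma h_pos:
  assumes "i \<le> N" "y < pos P i" "y \<in> points P" "0 < W s i N"
  shows "0 < h P s y i"
  using network.g_pos[OF network_mirror, of "N - i" "L - y" "mirror_w P s"] assms W_mirror[of i N s]
  by (simp add: g_mirror pos_mirror)

lemma Theta_R_decrease:
  assumes "0 < Theta_R P y s" "y' \<le> y" "y' \<in> points P" "y \<in> points P"
  shows "Theta_R P y s + (y - y') \<le> Theta_R P y' s"
  using network.Theta_L_increase[OF network_mirror, of "L - y" "mirror_w P s" "L - y'"] assms
  by (simp add: Theta_L_mirror)

lemma Theta_R_antimono: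
  assumes "y' \<le> y" "y' \<in> points P" "y \<in> points P"
  shows "Theta_R P y s \<le> Theta_R P y' s"
  using network.Theta_L_mono[OF network_mirror, of "L - y" "L - y'" "mirror_w P s"] assms
  by (simp add: Theta_L_mirror)

lemma Theta_R_right_cont:
  assumes "y \<in> points P" "y < L"
  shows "\<exists>z>y. \<forall>y'. y \<le> y' \<and> y' < z \<and> y' \<in> points P \<longrightarrow> Theta_R P y s \<le> Theta_R P y' s + (y' - y)"
proof -
  obtain z where z: "z < L - y"
    "\<And>y'. z < y' \<Longrightarrow> y' \<le> L - y \<Longrightarrow> Theta_L (mirror P) (L - y) (mirror_w P s)
        \<le> Theta_L (mirror P) y' (mirror_w P s) + (L - y - y')"
    using network.Theta_L_left_cont[OF network_mirror, of "L - y" "mirror_w P s"] assms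
    by (auto simp: pos_mirror)
  have "Theta_R P y s \<le> Theta_R P y' s + (y' - y)"
    if "y \<le> y'" "y' < L - z" "y' \<in> points P" for y'
    using z(2)[of "L - y'"] that assms by (simp add: Theta_L_mirror)
  then show ?thesis using z(1) by (intro exI[of _ "L - z"]) auto
qed

lemma Theta_R_compare:
  assumes "y \<in> points P" "0 \<le> d" "0 < C"
    and "\<And>i. i \<le> N \<Longrightarrow> y < pos P i \<Longrightarrow> 0 < W s i N \<Longrightarrow>
      0 < W s' i N \<and> W s i N \<le> W s' i N + d \<and> C \<le> cap_between P y (pos P i)"
  shows "Theta_R P y s \<le> Theta_R P y s' + d / C"
proof -
  have "Theta_L (mirror P) (L - y) (mirror_w P s) \<le> Theta_L (mirror P) (L - y) (mirror_w P s') + d / C"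
  proof (rule network.Theta_L_compare[OF network_mirror])
    fix i assume i: "i \<le> last_vertex (mirror P)" "pos (mirror P) i < L - y" "0 < W (mirror_w P s) 0 i"
    moreover have "W (mirror_w P s) 0 i = W s (N - i) N" "W (mirror_w P s') 0 i = W s' (N - i) N"
      using W_mirror[of "N - i" N] i by simp_all
    moreover have "cap_between (mirror P) (pos (mirror P) i) (L - y) = cap_between P y (pos P (N - i))"
      unfolding pos_mirror using i assms by (intro cap_between_mirror pos_in_points) (auto simp: pos_mirror)
    ultimately show "0 < W (mirror_w P s') 0 i \<and> W (mirror_w P s) 0 i \<le> W (mirror_w P s') 0 i + d
        \<and> C \<le> cap_between (mirror P) (pos (mirror P) i) (L - y)"
      using assms(4)[of "N - i"] by (simp add: pos_mirror)
  qed (use assms in auto)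
  then show ?thesis using assms by (simp add: Theta_L_mirror)
qed

lemma Theta_R_compare0:
  assumes "y \<in> points P" "\<And>i. i \<le> N \<Longrightarrow> y < pos P i \<Longrightarrow> W s i N \<le> W s' i N"
  shows "Theta_R P y s \<le> Theta_R P y s'"
  using Theta_R_compare[of y 0 cap_min s s'] assms cap_min_pos
  by (fastforce intro: cap_min_le pos_in_points)

text \<open>Reflection carries the maximizers of \<open>h\<close> onto those of \<open>g\<close> and
  reverses the order of indices, so the tie-break by \<open>Max\<close> on the left becomes the
  tie-break by \<open>Min\<close> on the right.\<close>

lemma RCV_mirror:
  assumes "y \<in> points P"
  shows "RCV P y s = map_option (\<lambda>l. N - l) (LCV (mirror P) (L - y) (mirror_w P s))"
proof (cases "right_vertices P y = {}")
  case False
  let ?g = "g (mirror P) (mirror_w P s) (L - y)" and ?h = "h P s y"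
  let ?A = "{i. is_arg_max ?g (\<lambda>k. k \<in> left_vertices (mirror P) (L - y)) i}"
  let ?B = "{i. is_arg_max ?h (\<lambda>k. k \<in> right_vertices P y) i}"
  have R: "i \<le> N" if "i \<in> right_vertices P y" for i using that by (simp add: right_vertices_def)
  have gh: "?g (N - i) = ?h i" if "i \<in> right_vertices P y" for i
    using that assms by (intro g_mirror) (auto simp: right_vertices_def)
  have "?A = {a \<in> (\<lambda>i. N - i) ` right_vertices P y.
      \<forall>b\<in>(\<lambda>i. N - i) ` right_vertices P y. \<not> ?g a < ?g b}"
    unfolding is_arg_max_def left_vertices_mirror by blast
  also have "\<dots> = (\<lambda>i. N - i) ` {i \<in> right_vertices P y.
      \<forall>j\<in>right_vertices P y. \<not> ?g (N - i) < ?g (N - j)}"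
    by blast
  also have "\<dots> = (\<lambda>i. N - i) ` ?B"
    using gh by (intro arg_cong[where f = "(`) _"]) (auto simp: is_arg_max_def)
  finally have AB: "?A = (\<lambda>i. N - i) ` ?B" .
  have finB: "finite ?B" "\<And>i. i \<in> ?B \<Longrightarrow> i \<le> N"
    by (auto simp: is_arg_max_def R intro: finite_subset[OF _ finite_right_vertices[of y]])
  have "Max (?h ` right_vertices P y) \<in> ?h ` right_vertices P y"
    using False by (intro Max_in) auto
  then obtain r where r: "r \<in> right_vertices P y" "?h r = Max (?h ` right_vertices P y)"
    by force
  then have "r \<in> ?B" by (auto simp: is_arg_max_def not_less)
  then have neB: "?B \<noteq> {}" by blast
  have "Max ((\<lambda>i. N - i) ` ?B) = N - Min ?B"
  proof (rule Max_eqI)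
    show "N - Min ?B \<in> (\<lambda>i. N - i) ` ?B" using finB(1) neB by (intro imageI Min_in)
    show "b \<le> N - Min ?B" if "b \<in> (\<lambda>i. N - i) ` ?B" for b
      using that Min_le[OF finB(1)] by (auto intro!: diff_le_mono2)
  qed (use finB in simp)
  moreover have "Min ?B \<le> N" using finB neB Min_in by blast
  ultimately show ?thesis
    using False by (simp add: RCV_def LCV_def AB left_vertices_mirror[symmetric])
      (simp add: left_vertices_mirror)
qed (simp add: RCV_def LCV_def left_vertices_mirror)

end

section \<open>Pushing weight to one side\<close>

text \<open>Induction on the right end. Whatever exceeds the lower bounds goes to the last position
  if it fits there, and that position is the pivot; otherwise the last position is filled up and the
  rest is distributed over the shorter interval.\<close>

lemma pack_right_ex:
  fixes lo up :: "nat \<Rightarrow> real"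
  assumes "a \<le> b" "\<And>t. t \<in> {a..b} \<Longrightarrow> lo t \<le> up t" "sum lo {a..b} \<le> M" "M \<le> sum up {a..b}"
  shows "\<exists>i f. i \<in> {a..b} \<and> (\<forall>t<i. f t = lo t) \<and> (\<forall>t>i. f t = up t) \<and>
    lo i \<le> f i \<and> f i \<le> up i \<and> sum f {a..b} = M"
  using assms
proof (induction b arbitrary: M rule: nat_induct_at_least)
  case base
  then show ?case
    by (intro exI[of _ a] exI[of _ "\<lambda>t. if t < a then lo t else if t = a then M else up t"]) auto
next
  case (Suc b)
  show ?case
  proof (cases "M - sum lo {a..b} \<le> up (Suc b)")
    case True
    define f where "f = (\<lambda>t. if t < Suc b then lo t else if t = Suc b then M - sum lo {a..b} else up t)"
    have "sum f {a..b} = sum lo {a..b}" by (intro sum.cong) (auto simp: f_def)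
    then show ?thesis
      using True Suc.prems Suc.hyps
      by (intro exI[of _ "Suc b"] exI[of _ f]) (auto simp: f_def)
  next
    case False
    have "\<exists>i f. i \<in> {a..b} \<and> (\<forall>t<i. f t = lo t) \<and> (\<forall>t>i. f t = up t) \<and>
      lo i \<le> f i \<and> f i \<le> up i \<and> sum f {a..b} = M - up (Suc b)"
      using False Suc.prems Suc.hyps by (intro Suc.IH) auto
    then obtain i f where "i \<in> {a..b}" "\<forall>t<i. f t = lo t" "\<forall>t>i. f t = up t"
      "lo i \<le> f i" "f i \<le> up i" "sum f {a..b} = M - up (Suc b)"
      by blast
    \<comment> \<open>Since \<open>f\<close> equals \<open>up\<close> everywhere beyond its pivot,
      the same \<open>f\<close> already has the right value at \<open>Suc b\<close>.\<close>
    then show ?thesis using Suc.hyps by (intro exI[of _ i] exI[of _ f]) auto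
  qed
qed

text \<open>Up to a point before the pivot, \<open>f\<close> is at the lower bounds, so its prefix
  sums are minimal. From the pivot on, the remaining suffix is at the upper bounds and the totals
  agree, so the prefix is again no heavier than that of \<open>s\<close>.\<close>

lemma pack_right:
  fixes lo up s :: "nat \<Rightarrow> real"
  assumes "a \<le> b" and s: "\<And>t. t \<in> {a..b} \<Longrightarrow> lo t \<le> s t \<and> s t \<le> up t"
  shows "\<exists>i f. i \<in> {a..b} \<and> (\<forall>t<i. f t = lo t) \<and> (\<forall>t>i. f t = up t) \<and>
    lo i \<le> f i \<and> f i \<le> up i \<and> sum f {a..b} = sum s {a..b} \<and>
    (\<forall>t\<in>{a..b}. sum f {a..t} \<le> sum s {a..t}) \<and>
    (\<forall>t\<in>{a..b}. sum s {t..b} \<le> sum f {t..b})"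
proof -
  have "\<exists>i f. i \<in> {a..b} \<and> (\<forall>t<i. f t = lo t) \<and> (\<forall>t>i. f t = up t) \<and>
      lo i \<le> f i \<and> f i \<le> up i \<and> sum f {a..b} = sum s {a..b}"
    using s by (intro pack_right_ex assms sum_mono) (auto intro: order_trans)
  then obtain i f where f: "i \<in> {a..b}" "\<And>t. t < i \<Longrightarrow> f t = lo t" "\<And>t. i < t \<Longrightarrow> f t = up t"
    "lo i \<le> f i" "f i \<le> up i" "sum f {a..b} = sum s {a..b}"
    by blast
  have split: "sum u {a..b} = sum u {a..t} + sum u {Suc t..b}" if "a \<le> Suc t" "t \<le> b" for u :: "nat \<Rightarrow> real" and t
  proof -
    have "{a..b} = {a..t} \<union> {Suc t..b}" "{a..t} \<inter> {Suc t..b} = {}" using that by auto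
    then show ?thesis by (simp add: sum.union_disjoint)
  qed
  \<comment> \<open>The condition \<open>a <= Suc t\<close> admits the empty prefix, so that the
    suffix starting at \<open>a\<close> is covered below as well.\<close>
  have pre: "sum f {a..t} \<le> sum s {a..t}" if t: "a \<le> Suc t" "t \<le> b" for t
  proof (cases "t < i")
    case True
    then show ?thesis using f s t by (intro sum_mono) auto
  next
    case False
    then have "sum s {Suc t..b} \<le> sum f {Suc t..b}" using f s t by (intro sum_mono) auto
    then show ?thesis using split[OF t, of f] split[OF t, of s] f by simp
  qed
  have "sum s {t..b} \<le> sum f {t..b}" if "t \<in> {a..b}" for t
  proof (cases t)
    case 0
    then show ?thesis using that f by simp
  next
    case (Suc t')
    then show ?thesis using that pre[of t'] split[of t' f] split[of t' s] f by simp
  qed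
  then show ?thesis using f pre by (intro exI[of _ i] exI[of _ f]) simp
qed

text \<open>Negating weights and exchanging the two bounds turns packing to the left into packing to
  the right. The inequality at \<open>a\<close> is the shortest prefix sum.\<close>

lemma pack_left:
  fixes lo up s :: "nat \<Rightarrow> real"
  assumes "a \<le> b" and s: "\<And>t. t \<in> {a..b} \<Longrightarrow> lo t \<le> s t \<and> s t \<le> up t"
  shows "\<exists>j f. j \<in> {a..b} \<and> (\<forall>t<j. f t = up t) \<and> (\<forall>t>j. f t = lo t) \<and>
    lo j \<le> f j \<and> f j \<le> up j \<and> sum f {a..b} = sum s {a..b} \<and> s a \<le> f a \<and>
    (\<forall>t\<in>{a..b}. sum f {t..b} \<le> sum s {t..b})"
proof -
  have "\<exists>j f. j \<in> {a..b} \<and> (\<forall>t<j. f t = - up t) \<and> (\<forall>t>j. f t = - lo t) \<and>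
    - up j \<le> f j \<and> f j \<le> - lo j \<and> sum f {a..b} = (\<Sum>t=a..b. - s t) \<and>
    (\<forall>t\<in>{a..b}. sum f {a..t} \<le> (\<Sum>t=a..t. - s t)) \<and>
    (\<forall>t\<in>{a..b}. (\<Sum>t=t..b. - s t) \<le> sum f {t..b})"
    using s by (intro pack_right[OF assms(1), of "\<lambda>t. - up t" "\<lambda>t. - s t" "\<lambda>t. - lo t"]) simp
  then obtain j f where f: "j \<in> {a..b}" "\<forall>t<j. f t = - up t" "\<forall>t>j. f t = - lo t"
    "- up j \<le> f j" "f j \<le> - lo j" "sum f {a..b} = (\<Sum>t=a..b. - s t)"
    "\<forall>t\<in>{a..b}. sum f {a..t} \<le> (\<Sum>t=a..t. - s t)"
    "\<forall>t\<in>{a..b}. (\<Sum>t=t..b. - s t) \<le> sum f {t..b}"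
    by blast
  have "sum (\<lambda>t. - f t) {t..b} \<le> sum s {t..b}" if "t \<in> {a..b}" for t
    using bspec[OF f(8) that] unfolding sum_negf by linarith
  then show ?thesis
    using f(1-6) bspec[OF f(7), of a] assms(1)
    by (intro exI[of _ j] exI[of _ "\<lambda>t. - f t"]) (auto simp: sum_negf)
qed

section \<open>Existence and uniqueness of the optimal point\<close>

context network
begin

text \<open>
  The minimizer is the point where the nondecreasing function \<open>Theta_L\<close> crosses the nonincreasing
  function \<open>Theta_R\<close>; one-sided continuity suffices at that point.
\<close>

lemma Theta_attains_min: "\<exists>c\<in>points P. \<forall>z\<in>points P. Theta P c s \<le> Theta P z s"
proof -
  \<comment> \<open>The points up to the crossing. Their supremum \<open>c\<close> need not belong
    to \<open>A\<close>, so both one-sided estimates pass to a limit.\<close>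
  define A where "A = {y \<in> points P. Theta_L P y s \<le> Theta_R P y s}"
  define c where "c = Sup A"
  have "left_vertices P (pos P 0) = {}" by (auto simp: left_vertices_def pos_less_iff)
  then have "Theta_L P (pos P 0) s = 0" by (simp add: Theta_L_def)
  then have A0: "pos P 0 \<in> A" using Theta_R_nonneg[of "pos P 0"] pos_in_points[of 0] by (simp add: A_def)
  have bdd: "bdd_above A" by (rule bdd_aboveI[of _ L]) (auto simp: A_def points_def)
  have cA: "y \<le> c" if "y \<in> A" for y unfolding c_def using that bdd by (rule cSup_upper)
  have "c \<le> L" unfolding c_def using A0 by (intro cSup_least) (auto simp: A_def points_def)
  then have c: "c \<in> points P" using cA[OF A0] by (simp add: points_def)
  \<comment> \<open>Choose \<open>y'\<close> in \<open>A\<close> between \<open>z\<close> and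
    \<open>c\<close> and within \<open>e\<close> of \<open>c\<close>. Left-continuity bounds
    \<open>Theta_L\<close> at \<open>c\<close> by \<open>Theta_L\<close> at \<open>y'\<close> up to
    \<open>e\<close>, and membership in \<open>A\<close> passes to \<open>Theta_R\<close>.\<close>
  have left: "Theta_L P c s \<le> Theta_R P z s" if z: "z \<in> points P" "z < c" for z
  proof (rule field_le_epsilon)
    fix e :: real assume "0 < e"
    obtain w where w: "w < c" "\<And>y'. w < y' \<Longrightarrow> y' \<le> c \<Longrightarrow> Theta_L P c s \<le> Theta_L P y' s + (c - y')"
      using Theta_L_left_cont[of c s] c z by (auto simp: points_def)
    have "max (max z w) (c - e) < Sup A" using z w \<open>0 < e\<close> by (simp add: c_def)
    then obtain y' where "y' \<in> A" "max (max z w) (c - e) < y'"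
      using less_cSupD[of A] A0 by blast
    then have y': "y' \<in> A" "z < y'" "w < y'" "c - e < y'" by auto
    then have "Theta_L P c s \<le> Theta_L P y' s + e" using w(2)[of y'] cA[of y'] by simp
    also have "Theta_L P y' s \<le> Theta_R P y' s" using y' by (simp add: A_def)
    also have "Theta_R P y' s \<le> Theta_R P z s" using y' z by (intro Theta_R_antimono) (auto simp: A_def)
    finally show "Theta_L P c s \<le> Theta_R P z s + e" by simp
  qed
  \<comment> \<open>Symmetrically, with right-continuity: points beyond \<open>c\<close> are outside
    \<open>A\<close>, so there \<open>Theta_R\<close> is below \<open>Theta_L\<close>.\<close>
  have right: "Theta_R P c s \<le> Theta_L P z s" if z: "z \<in> points P" "c < z" for z
  proof (rule field_le_epsilon)
    fix e :: real assume "0 < e"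
    obtain w where w: "c < w"
      "\<And>y'. c \<le> y' \<Longrightarrow> y' < w \<Longrightarrow> y' \<in> points P \<Longrightarrow> Theta_R P c s \<le> Theta_R P y' s + (y' - c)"
      using Theta_R_right_cont[of c s] c z by (auto simp: points_def)
    have "c < min (min z w) (c + e)" using z w \<open>0 < e\<close> by simp
    then obtain y' where "c < y'" "y' < min (min z w) (c + e)" using dense by blast
    then have y': "c < y'" "y' < z" "y' < w" "y' < c + e" by auto
    have "y' \<in> points P" using y' c z by (auto simp: points_def)
    then have "Theta_R P c s \<le> Theta_R P y' s + e" using w(2)[of y'] y' by simp
    also have "Theta_R P y' s \<le> Theta_L P y' s"
      using y' cA[of y'] \<open>y' \<in> points P\<close> unfolding A_def by fastforce
    also have "Theta_L P y' s \<le> Theta_L P z s" using y' z by (intro Theta_L_mono) auto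
    finally show "Theta_R P c s \<le> Theta_L P z s + e" by simp
  qed
  have "Theta P c s \<le> Theta P z s" if "z \<in> points P" for z
  proof (cases z c rule: linorder_cases)
    case less
    then show ?thesis using left[OF that less] Theta_R_antimono[of z c s] that c by (auto simp: Theta_def)
  next
    case greater
    then show ?thesis using right[OF that greater] Theta_L_mono[of c z s] that c by (auto simp: Theta_def)
  qed simp
  then show ?thesis using c by blast
qed

lemma Theta_nonneg: "y \<in> points P \<Longrightarrow> 0 \<le> Theta P y s"
  by (simp add: Theta_def Theta_L_nonneg le_max_iff_disj)

lemma Theta_OPT_le: "y \<in> points P \<Longrightarrow> Theta_OPT P s \<le> Theta P y s"
  unfolding Theta_OPT_def by (rule cINF_lower) (auto intro!: bdd_belowI[of _ 0] Theta_nonneg)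

lemma Theta_OPT_attained: "\<exists>y\<in>points P. Theta P y s = Theta_OPT P s"
proof -
  obtain c where c: "c \<in> points P" "\<And>z. z \<in> points P \<Longrightarrow> Theta P c s \<le> Theta P z s"
    using Theta_attains_min by blast
  then have "Theta P c s \<le> Theta_OPT P s" unfolding Theta_OPT_def by (intro cINF_greatest) auto
  then show ?thesis using c(1) Theta_OPT_le[of c s] by (auto intro!: bexI[of _ c] antisym)
qed

lemma x_OPT: "x_OPT P s \<in> points P" "Theta P (x_OPT P s) s = Theta_OPT P s"
proof -
  have "\<exists>y. y \<in> points P \<and> Theta P y s = Theta_OPT P s" using Theta_OPT_attained by blast
  then have "x_OPT P s \<in> points P \<and> Theta P (x_OPT P s) s = Theta_OPT P s"
    unfolding x_OPT_def by (rule someI_ex)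
  then show "x_OPT P s \<in> points P" "Theta P (x_OPT P s) s = Theta_OPT P s" by auto
qed

lemma Theta_OPT_nonneg: "0 \<le> Theta_OPT P s"
  using x_OPT[of s] Theta_nonneg by metis

lemma regret_nonneg: "y \<in> points P \<Longrightarrow> 0 \<le> regret P y s"
  by (simp add: regret_def Theta_OPT_le)

text \<open>A vertex of positive weight away from \<open>y\<close> has to travel and makes the
  evacuation time positive.\<close>

lemma Theta_eq_0_pos:
  assumes "nonneg s" "y \<in> points P" "Theta P y s = 0" "t \<le> N" "0 < s t"
  shows "pos P t = y"
proof (cases "pos P t" y rule: linorder_cases)
  case less
  have "0 < W s 0 t" using W_ge[OF assms(1), of 0 t t] assms by simp
  then have "0 < g P s y t" using assms less by (intro g_pos) auto
  then show ?thesis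
    using Theta_L_ge[of t y s] assms less by (auto simp: left_vertices_def Theta_def)
next
  case greater
  have "0 < W s t N" using W_ge[OF assms(1), of t t N] assms by simp
  then have "0 < h P s y t" using assms greater by (intro h_pos) auto
  then show ?thesis
    using Theta_R_ge[of t y s] assms greater by (auto simp: right_vertices_def Theta_def)
qed

text \<open>If the optimum is positive, then at the midpoint of two distinct minimizers both
  \<open>Theta_L\<close> and \<open>Theta_R\<close> are strictly below it, because each changes at
  rate at least one while positive. If the optimum is 0, both minimizers sit at the vertex of
  positive weight.\<close>

lemma optimal_le:
  assumes "nonneg s" "t \<le> N" "0 < s t" "y \<in> points P" "y' \<in> points P"
    "Theta P y s = Theta_OPT P s" "Theta P y' s = Theta_OPT P s"
  shows "y' \<le> y"
proof (rule ccontr)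
  assume "\<not> y' \<le> y"
  define z where "z = (y + y') / 2"
  have z: "z \<in> points P" "y < z" "z < y'"
    using \<open>\<not> y' \<le> y\<close> assms by (auto simp: z_def points_def)
  show False
  proof (cases "Theta_OPT P s = 0")
    case True
    then show False
      using Theta_eq_0_pos[of s y t] Theta_eq_0_pos[of s y' t] assms \<open>\<not> y' \<le> y\<close> by simp
  next
    case False
    then have pos: "0 < Theta_OPT P s" using Theta_OPT_nonneg[of s] by simp
    have "Theta_L P y' s \<le> Theta_OPT P s" "Theta_R P y s \<le> Theta_OPT P s"
      using assms by (auto simp: Theta_def)
    then have "Theta_L P z s < Theta_OPT P s" "Theta_R P z s < Theta_OPT P s"
      using Theta_L_increase[of z s y'] Theta_R_decrease[of z s y] pos z assms
      by (smt (verit))+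
    then show False using Theta_OPT_le[of z s] z by (simp add: Theta_def)
  qed
qed

lemma x_OPT_unique:
  assumes "nonneg s" "t \<le> N" "0 < s t" "y \<in> points P" "Theta P y s = Theta_OPT P s"
  shows "x_OPT P s = y"
  using optimal_le[of s t y "x_OPT P s"] optimal_le[of s t "x_OPT P s" y] assms x_OPT[of s]
  by (simp add: antisym)

end

section \<open>Scenarios within the intervals, and packing of a scenario\<close>

locale network_intervals = network +
  fixes wl wu :: "nat \<Rightarrow> real"
  assumes intervals: "weight_intervals P wl wu"
begin

abbreviation S :: "scenario set" where "S \<equiv> scenarios P wl wu"

lemma wl_bounds: "t \<le> N \<Longrightarrow> 0 \<le> wl t" "t \<le> N \<Longrightarrow> wl t \<le> wu t"
  using intervals by (auto simp: weight_intervals_def)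

lemma S_bounds: "s \<in> S \<Longrightarrow> t \<le> N \<Longrightarrow> wl t \<le> s t \<and> s t \<le> wu t"
  by (auto simp: scenarios_def PiE_def Pi_def)

lemma S_I: "(\<And>t. t \<le> N \<Longrightarrow> wl t \<le> s t \<and> s t \<le> wu t) \<Longrightarrow> restrict s {..N} \<in> S"
  by (auto simp: scenarios_def)

lemma S_nonneg: "s \<in> S \<Longrightarrow> nonneg s"
  using S_bounds wl_bounds by (force simp: nonneg_def)

lemma S_ij_I:
  assumes "s \<in> S" "i \<le> j" "j \<le> N"
    and "\<And>t. t \<le> N \<Longrightarrow> t < i \<or> j < t \<Longrightarrow> s t = wl t"
    and "\<And>t. i < t \<Longrightarrow> t < j \<Longrightarrow> s t = wu t"
  shows "s \<in> S_ij P wl wu i j"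
proof -
  have "s t = s_ij P wl wu i j (s i) (s j) t" for t
    using assms by (cases "t \<le> N") (auto simp: s_ij_def scenarios_def PiE_def extensional_def)
  then have "s = s_ij P wl wu i j (s i) (s j)" by blast
  moreover have "s i \<in> {wl i..wu i}" "s j \<in> {wl j..wu j}" "i = j \<longrightarrow> s i = s j"
    using S_bounds[OF assms(1)] assms(2,3) by auto
  ultimately show ?thesis unfolding S_ij_def by blast
qed

lemma W_split:
  assumes "i \<le> Suc j" "j \<le> k"
  shows "W s i k = W s i j + W s (Suc j) k"
proof -
  have "{i..k} = {i..j} \<union> {Suc j..k}" "{i..j} \<inter> {Suc j..k} = {}"
    using assms by auto
  then show ?thesis by (simp add: W_def sum.union_disjoint)
qed

text \<open>
  The interval from \<open>k\<close> to \<open>k'\<close> is the vertex or edge containing the point towards which weight is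
  pushed: first the vertices \<open>0, \<dots>, k\<close> are packed to the right, then \<open>k', \<dots>, l\<close> to the left. For
  \<open>k = k'\<close> the second step also acts on vertex \<open>k\<close>, which is already at its upper bound if \<open>i < k\<close>.
\<close>

lemma pack:
  assumes s: "s \<in> S" and k: "k \<le> k'" "k' \<le> Suc k" "k' \<le> l" "l \<le> N"
  obtains i j s' where "i \<le> k" "k' \<le> j" "j \<le> l" "s' \<in> S" "s' \<in> S_ij P wl wu i j"
    "W s' 0 l = W s 0 l"
    "\<forall>t<k'. W s' 0 t \<le> W s 0 t"
    "\<forall>t\<in>{l..N}. W s' 0 t \<le> W s 0 t"
    "\<forall>t\<in>{k<..N}. W s' t N \<le> W s t N"
    "i < k \<longrightarrow> s' k = wu k"
proof -
  obtain i f1 where f1: "i \<in> {0..k}" "\<forall>t<i. f1 t = wl t" "\<forall>t>i. f1 t = wu t"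
    "wl i \<le> f1 i" "f1 i \<le> wu i" "sum f1 {0..k} = sum s {0..k}"
    "\<forall>t\<in>{0..k}. sum f1 {0..t} \<le> sum s {0..t}"
  proof -
    have "wl t \<le> s t \<and> s t \<le> wu t" if "t \<in> {0..k}" for t using S_bounds[OF s, of t] that k by simp
    from pack_right[of 0 k wl s wu, OF _ this] show thesis using that by blast
  qed
  \<comment> \<open>\<open>s1\<close> is the scenario after the first packing. The second packing
    starts from it, since for \<open>k = k'\<close> both act on vertex \<open>k\<close>.\<close>
  define s1 where "s1 t = (if t \<le> k then f1 t else s t)" for t
  have s1b: "wl t \<le> s1 t \<and> s1 t \<le> wu t" if "t \<le> N" for t
    using f1(2-5) S_bounds[OF s that] wl_bounds(2)[OF that]
    by (cases t i rule: linorder_cases) (auto simp: s1_def)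
  obtain j f2 where f2: "j \<in> {k'..l}" "\<forall>t<j. f2 t = wu t" "\<forall>t>j. f2 t = wl t"
    "wl j \<le> f2 j" "f2 j \<le> wu j" "sum f2 {k'..l} = sum s1 {k'..l}" "s1 k' \<le> f2 k'"
    "\<forall>t\<in>{k'..l}. sum f2 {t..l} \<le> sum s1 {t..l}"
  proof -
    have "wl t \<le> s1 t \<and> s1 t \<le> wu t" if "t \<in> {k'..l}" for t using s1b[of t] that k by simp
    from pack_left[of k' l wl s1 wu, OF _ this] show thesis using k(3) that by blast
  qed
  have f2b: "wl t \<le> f2 t \<and> f2 t \<le> wu t" if "t \<le> N" for t
    using f2(2-5) wl_bounds(2)[OF that]
    by (cases t j rule: linorder_cases) auto
  define r where "r t = (if t < k' then s1 t else if t \<le> l then f2 t else wl t)" for t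
  define s' where "s' = restrict r {..N}"
  have s'S: "s' \<in> S" unfolding s'_def
    by (rule S_I) (use s1b f2b wl_bounds in \<open>auto simp: r_def\<close>)
  have s'r: "s' t = r t" if "t \<le> N" for t using that by (simp add: s'_def)
  have W0: "W s' 0 t = W f1 0 t" if "t < k'" for t
    unfolding W_def using that k by (intro sum.cong) (auto simp: s'r r_def s1_def)
  have WR: "W s' t l = W f2 t l" if "k' \<le> t" for t
    unfolding W_def using that k by (intro sum.cong) (auto simp: s'r r_def)
  have Ws1: "W s1 t l = W s t l" if "k < t" for t
    unfolding W_def using that by (intro sum.cong) (auto simp: s1_def)
  have "W s' 0 l = W s1 0 l"
  proof (cases k')
    case 0
    then show ?thesis using WR[of 0] f2(6) by (simp add: W_def)
  next
    case (Suc m)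
    have "W s' 0 m = W s1 0 m"
      unfolding W_def using Suc k by (intro sum.cong) (auto simp: s'r r_def)
    then show ?thesis
      using Suc k WR[of k'] f2(6) W_split[of 0 m l s'] W_split[of 0 m l s1] by (simp add: W_def)
  qed
  also have "\<dots> = W s 0 l"
  proof -
    have "W s1 0 k = W f1 0 k" unfolding W_def by (intro sum.cong) (auto simp: s1_def)
    then have "W s1 0 k = W s 0 k" using f1(6) by (simp add: W_def)
    then show ?thesis using Ws1[of "Suc k"] W_split[of 0 k l s1] W_split[of 0 k l s] k by simp
  qed
  finally have Wl: "W s' 0 l = W s 0 l" .
  \<comment> \<open>Beyond \<open>l\<close> the new scenario is at its lower bounds, so no sum over
    vertices there can have grown.\<close>
  have tail: "W s' (Suc m) t \<le> W s (Suc m) t" if "l \<le> m" "t \<le> N" for m t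
    unfolding W_def using that S_bounds[OF s] k by (intro sum_mono) (auto simp: s'r r_def)
  show thesis
  proof (rule that[of i j s'])
    show "i \<le> k" "k' \<le> j" "j \<le> l" using f1 f2 by auto
    show "s' \<in> S_ij P wl wu i j"
    proof (rule S_ij_I[OF s'S])
      show "i \<le> j" "j \<le> N" using f1 f2 k by auto
      show "s' t = wl t" if "t \<le> N" "t < i \<or> j < t" for t
        using that f1(1,2) f2(1,3) k by (auto simp: s'r r_def s1_def)
      show "s' t = wu t" if "i < t" "t < j" for t
        using that f1(1,3) f2(1,2) k by (auto simp: s'r r_def s1_def)
    qed
    show "W s' 0 l = W s 0 l" by fact
    show "\<forall>t<k'. W s' 0 t \<le> W s 0 t"
    proof (intro allI impI)
      fix t assume t: "t < k'"
      then show "W s' 0 t \<le> W s 0 t"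
        using bspec[OF f1(7), of t] k unfolding W0[OF t] by (simp add: W_def)
    qed
    show "\<forall>t\<in>{l..N}. W s' 0 t \<le> W s 0 t"
    proof
      fix t assume "t \<in> {l..N}"
      then show "W s' 0 t \<le> W s 0 t"
        using W_split[of 0 l t s'] W_split[of 0 l t s] tail[of l t] Wl by simp
    qed
    show "\<forall>t\<in>{k<..N}. W s' t N \<le> W s t N"
    proof
      fix t assume t: "t \<in> {k<..N}"
      show "W s' t N \<le> W s t N"
      proof (cases "t \<le> l")
        case True
        have "W s' t l \<le> W s t l"
          using WR[of t] bspec[OF f2(8), of t] Ws1[of t] t True k by (simp add: W_def)
        then show ?thesis
          using W_split[of t l N s'] W_split[of t l N s] tail[of l N] True k by simp
      next
        case False
        then show ?thesis using tail[of "t - 1" N] t by simp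
      qed
    qed
    show "i < k \<longrightarrow> s' k = wu k"
    proof (cases "k < k'")
      case True
      then show ?thesis using f1(3) k by (simp add: s'r r_def s1_def)
    next
      case False
      then have "k' = k" using k by simp
      then show ?thesis using f1(3) f2(7) f2b[of k] k by (auto simp: s'r r_def s1_def)
    qed
  qed (fact s'S)
qed

end

section \<open>Worst-case scenarios\<close>

text \<open>Sequential compactness of a box, one coordinate at a time: a monotone subsequence in the
  new coordinate converges, and thinning out preserves the limits already found.\<close>

lemma bounded_sequence_convergent_subsequence:
  fixes f :: "nat \<Rightarrow> nat \<Rightarrow> real"
  assumes "\<And>m t. t < k \<Longrightarrow> lo t \<le> f m t \<and> f m t \<le> up t"
  shows "\<exists>r z. strict_mono (r :: nat \<Rightarrow> nat) \<and> (\<forall>t<k. (\<lambda>m. f (r m) t) \<longlonglongrightarrow> z t)"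
  using assms
proof (induction k)
  case 0
  then show ?case by (auto intro!: exI[of _ id] simp: strict_mono_def)
next
  case (Suc k)
  then obtain r z where r: "strict_mono r" "\<And>t. t < k \<Longrightarrow> (\<lambda>m. f (r m) t) \<longlonglongrightarrow> z t"
    by (metis less_SucI)
  obtain q :: "nat \<Rightarrow> nat" where q: "strict_mono q" "monoseq (\<lambda>m. f (r (q m)) k)"
    using seq_monosub[of "\<lambda>m. f (r m) k"] by auto
  have "Bseq (\<lambda>m. f (r (q m)) k)"
    using Suc.prems[of k] by (intro BseqI'[where K = "max \<bar>lo k\<bar> \<bar>up k\<bar>"]) (smt (verit) lessI real_norm_def)
  then obtain a where a: "(\<lambda>m. f (r (q m)) k) \<longlonglongrightarrow> a"
    using q(2) Bseq_monoseq_convergent convergent_def by blast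
  have "(\<lambda>m. f (r (q m)) t) \<longlonglongrightarrow> (z(k := a)) t" if "t < Suc k" for t
  proof (cases "t = k")
    case False
    then show ?thesis using LIMSEQ_subseq_LIMSEQ[OF r(2)[of t] q(1)] that by (simp add: o_def)
  qed (use a in simp)
  moreover have "strict_mono (\<lambda>m. r (q m))" using strict_mono_o[OF r(1) q(1)] by (simp add: o_def)
  ultimately show ?case by (intro exI[of _ "\<lambda>m. r (q m)"] exI[of _ "z(k := a)"]) blast
qed

section \<open>Semicontinuity of the optimum, and its position relative to a point with
  regret\<close>

context network
begin

text \<open>A weight sum that is positive in the limit is eventually positive and almost as large,
  while one that vanishes in the limit contributes 0 there. Hence the limit scenario, evaluated at
  the optimum of \<open>f m\<close>, is hardly worse than \<open>f m\<close> itself.\<close>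

lemma Theta_OPT_lower_semicontinuous:
  assumes f: "\<And>t. t \<le> N \<Longrightarrow> (\<lambda>m. f m t) \<longlonglongrightarrow> s t" and "0 < e"
  shows "\<forall>\<^sub>F m in sequentially. Theta_OPT P s \<le> Theta_OPT P (f m) + e"
proof -
  \<comment> \<open>The tolerance \<open>e * cap_min\<close> in weight costs at most
    \<open>e\<close> in time.\<close>
  let ?Q = "\<lambda>i j m. 0 < W s i j \<longrightarrow> 0 < W (f m) i j \<and> W s i j \<le> W (f m) i j + e * cap_min"
  have "\<forall>\<^sub>F m in sequentially. ?Q i j m" if "j \<le> N" for i j
  proof (cases "0 < W s i j")
    case True
    have "(\<lambda>m. W (f m) i j) \<longlonglongrightarrow> W s i j"
      unfolding W_def using that by (intro tendsto_sum f) auto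
    moreover have "0 < e * cap_min" using \<open>0 < e\<close> cap_min_pos by simp
    ultimately have "\<forall>\<^sub>F m in sequentially. 0 < W (f m) i j"
      "\<forall>\<^sub>F m in sequentially. W s i j - e * cap_min < W (f m) i j"
      using True by (auto intro: order_tendstoD)
    then show ?thesis by eventually_elim auto
  qed simp
  then have "\<forall>\<^sub>F m in sequentially. \<forall>j\<in>{..N}. \<forall>i\<in>{..N}. ?Q i j m"
    by (intro eventually_ball_finite ballI) auto
  then show ?thesis
  proof eventually_elim
    case (elim m)
    let ?y = "x_OPT P (f m)"
    have "Theta_L P ?y s \<le> Theta_L P ?y (f m) + (e * cap_min) / cap_min"
      using elim \<open>0 < e\<close> cap_min_pos x_OPT(1)[of "f m"]
      by (intro Theta_L_compare) (auto intro!: cap_min_le pos_in_points)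
    moreover have "Theta_R P ?y s \<le> Theta_R P ?y (f m) + (e * cap_min) / cap_min"
      using elim \<open>0 < e\<close> cap_min_pos x_OPT(1)[of "f m"]
      by (intro Theta_R_compare) (auto intro!: cap_min_le pos_in_points)
    ultimately have "Theta P ?y s \<le> Theta P ?y (f m) + e"
      using cap_min_pos by (auto simp: Theta_def)
    then show ?case using Theta_OPT_le[of ?y s] x_OPT[of "f m"] by simp
  qed
qed

text \<open>At or to the right of \<open>y\<close> the left evacuation time is at least that at
  \<open>y\<close>, so an optimum there would leave no regret.\<close>

lemma x_OPT_less:
  assumes "y \<in> points P" "0 < regret P y s" "Theta P y s = Theta_L P y s"
  shows "x_OPT P s < y"
proof (rule ccontr)
  assume "\<not> x_OPT P s < y"
  then have "Theta_L P y s \<le> Theta_L P (x_OPT P s) s" by (intro Theta_L_mono x_OPT) auto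
  then show False using assms x_OPT(2)[of s] by (auto simp: regret_def Theta_def)
qed

end

section \<open>Reshaping a worst case on the left side\<close>

context network_intervals
begin

lemma low_in_S: "restrict wl {..N} \<in> S"
  by (rule S_I) (simp add: wl_bounds)

lemma W_le_wu: "s \<in> S \<Longrightarrow> j \<le> N \<Longrightarrow> W s i j \<le> W wu i j"
  unfolding W_def using S_bounds by (intro sum_mono) auto

lemma W_ge_wl: "s \<in> S \<Longrightarrow> j \<le> N \<Longrightarrow> W wl i j \<le> W s i j"
  unfolding W_def using S_bounds by (intro sum_mono) auto

text \<open>Supplies the upper bound needed to reason about suprema of regrets in the reals.\<close>

lemma regret_le:
  assumes s: "s \<in> S" "y \<in> points P"
  shows "regret P y s \<le> Theta P y wu"
proof -
  have "Theta_L P y s \<le> Theta_L P y wu" "Theta_R P y s \<le> Theta_R P y wu"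
    using s by (auto intro!: Theta_L_compare0 Theta_R_compare0 W_le_wu)
  then show ?thesis using Theta_OPT_nonneg[of s] by (simp add: regret_def Theta_def)
qed

lemma worst_case_iff:
  assumes "x \<in> points P"
  shows "worst_case P wl wu x s \<longleftrightarrow> s \<in> S \<and> (\<forall>s'\<in>S. regret P x s' \<le> regret P x s)"
proof -
  have bdd: "bdd_above (regret P x ` S)"
    using regret_le assms by (intro bdd_aboveI2[of _ _ "Theta P x wu"]) auto
  have "regret P x s = (SUP s'\<in>S. regret P x s')"
    if "s \<in> S" "\<forall>s'\<in>S. regret P x s' \<le> regret P x s"
    using that by (intro cSup_eq_maximum[symmetric]) auto
  then show ?thesis using cSUP_upper[OF _ bdd] by (auto simp: worst_case_def max_regret_def)
qed

text \<open>Chooses the target of \<open>pack\<close>: vertex \<open>l\<close> if \<open>y\<close>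
  is not left of it, otherwise the vertex at \<open>y\<close> or the two ends of the edge containing
  \<open>y\<close>. The two quantified conditions say that the vertices contributing at
  \<open>y\<close> are among those whose prefix or suffix weight \<open>pack\<close> does not
  raise.\<close>

lemma optimum_packing:
  assumes "y \<in> points P" "l \<le> N"
  obtains k k' where "k \<le> k'" "k' \<le> Suc k" "k' \<le> l"
    "\<forall>t\<le>N. pos P t < y \<longrightarrow> t < k' \<or> l \<le> t"
    "\<forall>t\<le>N. y < pos P t \<longrightarrow> k < t"
    "pos P l \<le> y \<longrightarrow> k = l \<and> k' = l" "y < pos P l \<longrightarrow> pos P k \<le> y \<and> y \<le> pos P k'"
proof (cases "pos P l \<le> y")
  case True
  have "l < t" if "t \<le> N" "y < pos P t" for t
    using True that assms pos_less_iff[of l t] by simp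
  then show ?thesis using True by (intro that[of l l]) auto
next
  case False
  define k where "k = Max {t. t \<le> N \<and> pos P t \<le> y}"
  have fin: "finite {t. t \<le> N \<and> pos P t \<le> y}" by simp
  moreover have "{t. t \<le> N \<and> pos P t \<le> y} \<noteq> {}" using assms by (auto simp: points_def)
  ultimately have "k \<in> {t. t \<le> N \<and> pos P t \<le> y}" unfolding k_def by (rule Max_in)
  then have k: "k \<le> N" "pos P k \<le> y" by auto
  have kmax: "t \<le> k" if "t \<le> N" "pos P t \<le> y" for t
    unfolding k_def using fin that by (intro Max_ge) auto
  have "k < l" using k False assms pos_less_iff[of k l] by simp
  then have Suc: "y < pos P (Suc k)" using kmax[of "Suc k"] assms by force
  have right: "k < t" if "t \<le> N" "y < pos P t" for t
    using that k pos_less_iff[of k t] by simp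
  show ?thesis
  proof (cases "pos P k = y")
    case True
    then show ?thesis
      using \<open>k < l\<close> False right pos_less_iff k by (intro that[of k k]) auto
  next
    case False
    have "t < Suc k" if "t \<le> N" "pos P t < y" for t using kmax[of t] that by simp
    then show ?thesis
      using \<open>k < l\<close> \<open>\<not> pos P l \<le> y\<close> Suc right k by (intro that[of k "Suc k"]) auto
  qed
qed

lemma left_worst_case:
  assumes x: "x \<in> points P" and s: "s \<in> S" and max: "\<forall>s'\<in>S. regret P x s' \<le> regret P x s"
    and pos: "0 < regret P x s" and left: "Theta P x s = Theta_L P x s"
  obtains i j s' where "i \<le> j" "j \<le> N" "worst_case P wl wu x s'" "s' \<in> S_ij P wl wu i j"
    "Theta P x s' = Theta_L P x s'" "\<exists>t\<le>N. 0 < s' t"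
    "(LCV P x s' = Some j \<and> pos P j \<le> x_OPT P s' \<and> x_OPT P s' \<le> x \<and> pos P j < x \<and>
       (i = j \<or> i < j \<and> s' j = wu j)) \<or>
     ((\<exists>l. LCV P x s' = Some l \<and> l \<ge> j) \<and>
       pos P i \<le> x_OPT P s' \<and> x_OPT P s' \<le> pos P j \<and> pos P j \<le> x)"
proof -
  have "0 < Theta_L P x s" using pos left Theta_OPT_nonneg[of s] by (simp add: regret_def)
  then have "left_vertices P x \<noteq> {}" by (auto simp: Theta_L_def)
  then obtain l where LCV: "LCV P x s = Some l" by (rule LCV_exists)
  then have l: "l \<in> left_vertices P x" "Theta_L P x s = g P s x l"
    and lmax: "\<And>t. t \<in> left_vertices P x \<Longrightarrow> l < t \<Longrightarrow> g P s x t < g P s x l"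
    by (auto simp: LCV_iff)
  then have lN: "l \<le> N" "pos P l < x" by (auto simp: left_vertices_def)
  have Wl: "0 < W s 0 l" using \<open>0 < Theta_L P x s\<close> l by (auto simp: g_def split: if_splits)
  define y where "y = x_OPT P s"
  have y: "y \<in> points P" "Theta P y s = Theta_OPT P s" unfolding y_def by (fact x_OPT)+
  have "y < x" unfolding y_def using x pos left by (rule x_OPT_less)
  obtain k k' where k: "k \<le> k'" "k' \<le> Suc k" "k' \<le> l"
    "\<forall>t\<le>N. pos P t < y \<longrightarrow> t < k' \<or> l \<le> t"
    "\<forall>t\<le>N. y < pos P t \<longrightarrow> k < t"
    "pos P l \<le> y \<longrightarrow> k = l \<and> k' = l" "y < pos P l \<longrightarrow> pos P k \<le> y \<and> y \<le> pos P k'"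
    using optimum_packing[OF y(1) lN(1)] .
  obtain i j s' where s': "i \<le> k" "k' \<le> j" "j \<le> l" "s' \<in> S" "s' \<in> S_ij P wl wu i j"
    "W s' 0 l = W s 0 l"
    "\<forall>t<k'. W s' 0 t \<le> W s 0 t"
    "\<forall>t\<in>{l..N}. W s' 0 t \<le> W s 0 t"
    "\<forall>t\<in>{k<..N}. W s' t N \<le> W s t N"
    "i < k \<longrightarrow> s' k = wu k"
    using pack[OF s k(1-3) lN(1)] .
  have gl: "g P s' x l = g P s x l" using s'(6) by (simp add: g_def)
  have "Theta_L P y s' \<le> Theta_L P y s" using y k(4) s'(7,8) by (intro Theta_L_compare0) auto
  moreover have "Theta_R P y s' \<le> Theta_R P y s" using y k(5) s'(9) by (intro Theta_R_compare0) auto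
  ultimately have y_le: "Theta P y s' \<le> Theta P y s" by (auto simp: Theta_def)
  have "g P s' x l \<le> Theta_L P x s'" using Theta_L_ge[OF l(1)] .
  moreover have "Theta_L P x s' \<le> Theta P x s'" by (simp add: Theta_def)
  moreover have "Theta_OPT P s' \<le> Theta P y s'" using y by (intro Theta_OPT_le)
  moreover have "regret P x s' \<le> regret P x s" using s' max by blast
  \<comment> \<open>The regret of \<open>s'\<close> is at least
    \<open>g P s' x l - Theta P y s'\<close>, which is at least the regret of \<open>s\<close>. As
    \<open>s\<close> is a worst case, every inequality in between is an equality.\<close>
  ultimately have eqs: "Theta P x s' = Theta_L P x s'" "Theta_L P x s' = g P s' x l"
    "Theta_OPT P s' = Theta P y s'" "regret P x s' = regret P x s"
    using y_le y(2) gl l(2) left unfolding regret_def by linarith+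
  have wc: "worst_case P wl wu x s'" using s'(4) eqs(4) max x by (simp add: worst_case_iff)
  \<comment> \<open>Positive weight makes the optimum unique, so \<open>x_OPT\<close> is
    \<open>y\<close> and not another minimizer. The conclusion records this weight because
    reflection needs uniqueness again.\<close>
  obtain t where "t \<in> {0..l}" "0 < s' t"
    using W_pos_ex[of s' 0 l] Wl s'(6) by auto
  then have t: "t \<le> N" "0 < s' t" using lN by auto
  then have xo: "x_OPT P s' = y"
    using y eqs(3) by (intro x_OPT_unique[of s' t] S_nonneg s'(4)) auto
  obtain l' where LCV': "LCV P x s' = Some l'" using LCV_exists \<open>left_vertices P x \<noteq> {}\<close> by blast
  have l': "l' \<in> left_vertices P x" "g P s' x l' = g P s' x l" "l \<le> l'"
    using LCV' eqs(2) l(1) by (auto simp: LCV_iff not_le[symmetric])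
  show thesis
  proof (rule that[of i j s'])
    show "i \<le> j" "j \<le> N" using s' k lN by auto
    have "(LCV P x s' = Some j \<and> pos P j \<le> y \<and> y \<le> x \<and> pos P j < x \<and> (i = j \<or> i < j \<and> s' j = wu j))"
      if "pos P l \<le> y"
    proof -
      have kl: "k = l" "k' = l" "j = l" using k(6) that s' by auto
      \<comment> \<open>A maximizer beyond \<open>l\<close> in the new scenario would do at least as
        well in the old one, against the choice of \<open>l\<close> as the last maximizer
        there.\<close>
      have "\<not> l < l'"
      proof
        assume "l < l'"
        have "l' \<le> N" "pos P l' < x" using l'(1) by (auto simp: left_vertices_def)
        then have "W s' 0 l' \<le> W s 0 l'" using s'(8) \<open>l < l'\<close> by auto
        moreover have "0 < cap_between P (pos P l') x"
          using \<open>l' \<le> N\<close> \<open>pos P l' < x\<close> x by (intro cap_between_pos pos_in_points) auto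
        ultimately have "g P s' x l' \<le> g P s x l'"
          using g_nonneg[of l' x s] \<open>l' \<le> N\<close> \<open>pos P l' < x\<close> x by (auto simp: g_def divide_right_mono)
        then show False using lmax[OF l'(1) \<open>l < l'\<close>] l'(2) gl by simp
      qed
      then show ?thesis using LCV' l'(3) kl that lN \<open>y < x\<close> s'(1,10) by auto
    qed
    moreover have "((\<exists>l. LCV P x s' = Some l \<and> l \<ge> j) \<and> pos P i \<le> y \<and> y \<le> pos P j \<and> pos P j \<le> x)"
      if "y < pos P l"
    proof -
      have "pos P i \<le> pos P k" "pos P k' \<le> pos P j" "pos P j \<le> pos P l"
        using s' k lN by (auto simp: pos_le_iff)
      then show ?thesis using k(7) that LCV' l'(3) s'(3) lN by force
    qed
    ultimately show "(LCV P x s' = Some j \<and> pos P j \<le> x_OPT P s' \<and> x_OPT P s' \<le> x \<and> pos P j < x \<and>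
        (i = j \<or> i < j \<and> s' j = wu j)) \<or>
      ((\<exists>l. LCV P x s' = Some l \<and> l \<ge> j) \<and>
        pos P i \<le> x_OPT P s' \<and> x_OPT P s' \<le> pos P j \<and> pos P j \<le> x)"
      unfolding xo by (meson not_le)
  qed (use wc s' eqs t in auto)
qed

section \<open>Existence of a worst case through dominating scenarios\<close>

lemma large_dominated:
  assumes x: "x \<in> points P" and l: "l \<in> left_vertices P x" and "0 < \<eta>"
  shows "\<exists>s0\<in>S. \<forall>s\<in>S. \<eta> \<le> W s 0 l \<longrightarrow> Theta P x s = g P s x l \<longrightarrow> regret P x s \<le> regret P x s0"
proof -
  define K where "K = {s \<in> S. \<eta> \<le> W s 0 l}"
  \<comment> \<open>\<open>F\<close> never exceeds the regret and agrees with it where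
    \<open>g\<close> at \<open>l\<close> attains \<open>Theta\<close>. On \<open>K\<close> the
    weight stays away from 0, so \<open>g\<close> is continuous in the scenario; with
    \<open>Theta_OPT\<close> lower semicontinuous, \<open>F\<close> is upper semicontinuous and
    attains its supremum.\<close>
  define F where "F s = g P s x l - Theta_OPT P s" for s
  have lN: "l \<le> N" "pos P l < x" using l by (auto simp: left_vertices_def)
  have F_le: "F s \<le> regret P x s" for s
    using Theta_L_ge[OF l, of s] by (simp add: F_def regret_def Theta_def)
  show ?thesis
  proof (cases "K = {}")
    case True
    then show ?thesis using low_in_S by (auto simp: K_def)
  next
    case False
    define Q where "Q = (SUP s\<in>K. F s)"
    have bdd: "bdd_above (F ` K)"
      using regret_le x F_le by (intro bdd_aboveI2[of _ _ "Theta P x wu"]) (force simp: K_def intro: order_trans)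
    have "\<exists>s\<in>K. Q - 1 / real (Suc m) < F s" for m
      using less_cSUP_iff[OF False bdd, of "Q - 1 / real (Suc m)"] by (simp add: Q_def)
    then obtain f where f: "\<And>m. f m \<in> K" "\<And>m. Q - 1 / real (Suc m) < F (f m)" by metis
    have "\<exists>r z. strict_mono (r :: nat \<Rightarrow> nat) \<and> (\<forall>t<Suc N. (\<lambda>m. f (r m) t) \<longlonglongrightarrow> z t)"
      by (rule bounded_sequence_convergent_subsequence[of _ wl _ wu])
        (use f(1) S_bounds in \<open>auto simp: K_def less_Suc_eq_le\<close>)
    then obtain r z where r: "strict_mono r" "\<And>t. t \<le> N \<Longrightarrow> (\<lambda>m. f (r m) t) \<longlonglongrightarrow> z t"
      by (auto simp: less_Suc_eq_le)
    define s0 where "s0 = restrict z {..N}"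
    have conv: "(\<lambda>m. f (r m) t) \<longlonglongrightarrow> s0 t" if "t \<le> N" for t using r(2) that by (simp add: s0_def)
    have fS: "f m \<in> S" "\<eta> \<le> W (f m) 0 l" for m using f(1)[of m] by (auto simp: K_def)
    have "s0 \<in> S" unfolding s0_def
    proof (rule S_I)
      show "wl t \<le> z t \<and> z t \<le> wu t" if "t \<le> N" for t
        using LIMSEQ_le_const[OF r(2)[OF that], of "wl t"] LIMSEQ_le_const2[OF r(2)[OF that], of "wu t"]
          S_bounds[OF fS(1) that] by blast
    qed
    have Wconv: "(\<lambda>m. W (f (r m)) 0 l) \<longlonglongrightarrow> W s0 0 l"
      unfolding W_def using lN by (intro tendsto_sum conv) auto
    then have "\<eta> \<le> W s0 0 l" using fS(2) by (intro LIMSEQ_le_const[OF Wconv]) auto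
    have cap: "cap_between P (pos P l) x \<noteq> 0"
      using cap_between_pos[of "pos P l" x] lN x pos_in_points[of l] by simp
    have "(\<lambda>m. (x - pos P l) + W (f (r m)) 0 l / cap_between P (pos P l) x)
        \<longlonglongrightarrow> (x - pos P l) + W s0 0 l / cap_between P (pos P l) x"
      using cap by (intro tendsto_intros Wconv)
    moreover have "0 < W (f m) 0 l" "0 < W s0 0 l" for m
      using fS(2)[of m] \<open>\<eta> \<le> W s0 0 l\<close> \<open>0 < \<eta>\<close> by auto
    ultimately have gconv: "(\<lambda>m. g P (f (r m)) x l) \<longlonglongrightarrow> g P s0 x l" by (simp add: g_def)
    have "Q \<le> F s0"
    proof (rule field_le_epsilon)
      fix e :: real assume "0 < e"
      have "\<forall>\<^sub>F m in sequentially. g P (f (r m)) x l < g P s0 x l + e / 3"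
        using gconv \<open>0 < e\<close> by (intro order_tendstoD) auto
      moreover have "\<forall>\<^sub>F m in sequentially. Theta_OPT P s0 \<le> Theta_OPT P (f (r m)) + e / 3"
        using conv \<open>0 < e\<close> by (intro Theta_OPT_lower_semicontinuous) auto
      moreover have "\<forall>\<^sub>F m in sequentially. 1 / real (Suc m) < e / 3"
        using \<open>0 < e\<close> LIMSEQ_inverse_real_of_nat by (intro order_tendstoD) (auto simp: inverse_eq_divide)
      ultimately have "\<forall>\<^sub>F m in sequentially. Q \<le> F s0 + e"
      proof eventually_elim
        case (elim m)
        have "1 / real (Suc (r m)) \<le> 1 / real (Suc m)"
          using seq_suble[OF r(1), of m] by (simp add: divide_left_mono)
        then show ?case using elim f(2)[of "r m"] unfolding F_def by linarith
      qed
      then show "Q \<le> F s0 + e" by simp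
    qed
    moreover have "F s \<le> Q" if "s \<in> K" for s unfolding Q_def using that bdd by (rule cSUP_upper)
    ultimately have "regret P x s \<le> regret P x s0" if "s \<in> K" "Theta P x s = g P s x l" for s
      using that F_le[of s0] unfolding F_def regret_def by fastforce
    then show ?thesis using \<open>s0 \<in> S\<close> by (auto simp: K_def)
  qed
qed

text \<open>
  Here all weight up to \<open>l\<close> can be moved to \<open>p\<close>. Raising the weight of \<open>p\<close> afterwards increases
  \<open>g\<close> at \<open>x\<close> at least as fast as \<open>Theta_L\<close> to the left of \<open>x\<close>, since capacities only shrink with distance.
\<close>

lemma small_dominated:
  assumes x: "x \<in> points P" and l: "l \<in> left_vertices P x"
    and wl0: "\<And>t. t \<le> l \<Longrightarrow> wl t = 0"
    and p: "p \<le> l" "\<And>t. p < t \<Longrightarrow> t \<le> l \<Longrightarrow> wu t = 0"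
    and s: "s \<in> S" "0 < W s 0 l" "W s 0 l \<le> wu p"
    and pos: "0 < regret P x s" and left: "Theta P x s = g P s x l"
  shows "regret P x s \<le> regret P x (restrict (wl(p := wu p)) {..N})"
proof -
  define sp where "sp = restrict (wl(p := wu p)) {..N}"
  have lN: "l \<le> N" "pos P l < x" using l by (auto simp: left_vertices_def)
  have pN: "p \<le> N" "pos P p \<le> pos P l" "pos P p < x" "p \<in> left_vertices P x"
    using p(1) lN pos_le_iff[of p l] by (auto simp: left_vertices_def)
  define d where "d = wu p - W s 0 l"
  define C where "C = cap_between P (pos P p) x"
  have C: "0 < C" unfolding C_def using pN x by (intro cap_between_pos pos_in_points)
  have "0 \<le> d" using s by (simp add: d_def)
  have Wsp0: "W sp 0 t = 0" if "t < p" for t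
    unfolding W_def using that p(1) wl0 lN by (intro sum.neutral) (auto simp: sp_def)
  have Wp: "W sp 0 p = wu p"
    using W_split[of 0 "p - 1" p sp] Wsp0[of "p - 1"] pN by (cases p) (auto simp: W_def sp_def)
  have Wsp_le: "W sp (Suc m) t \<le> W s (Suc m) t" if "p \<le> m" "t \<le> N" for m t
    unfolding W_def using that S_bounds[OF s(1)] by (intro sum_mono) (auto simp: sp_def)
  \<comment> \<open>Nothing can sit strictly between \<open>p\<close> and \<open>l\<close> or at
    \<open>l\<close> itself unless \<open>l = p\<close>, so the weight of \<open>0, ..., l\<close>
    already lies in \<open>0, ..., p\<close>.\<close>
  have Ws: "W s 0 l \<le> W s 0 t" if "p \<le> t" "t \<le> N" for t
  proof (cases "t \<le> l")
    case True
    have "s u = 0" if "t < u" "u \<le> l" for u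
      using S_bounds[OF s(1), of u] p(2)[of u] wl0[of u] that \<open>p \<le> t\<close> lN by auto
    then have "W s (Suc t) l = 0" unfolding W_def by (intro sum.neutral) auto
    then show ?thesis using W_split[of 0 t l s] True by simp
  next
    case False
    then show ?thesis
      using W_split[of 0 l t s] W_nonneg[OF S_nonneg[OF s(1)], of t "Suc l"] that by simp
  qed
  have Wsp: "W sp 0 t \<le> W s 0 t + d" if "p \<le> t" "t \<le> N" for t
    using W_split[of 0 p t sp] W_split[of 0 p t s] Wsp_le[of p t] Wp Ws[of p] pN that by (simp add: d_def)
  define y where "y = x_OPT P s"
  have y: "y \<in> points P" "Theta P y s = Theta_OPT P s" unfolding y_def by (fact x_OPT)+
  have "Theta P x s = Theta_L P x s"
    using left Theta_L_ge[OF l, of s] by (simp add: Theta_def)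
  then have "y < x" unfolding y_def using x pos by (intro x_OPT_less)
  \<comment> \<open>The point at which the optimum of \<open>sp\<close> is estimated: the optimum of
    \<open>s\<close>, moved right to \<open>p\<close> if it lies before \<open>p\<close>. At
    \<open>p\<close> itself no weight of \<open>sp\<close> is on the left; beyond \<open>p\<close>
    the added weight \<open>d\<close> costs at most \<open>d / C\<close>.\<close>
  define u where "u = max y (pos P p)"
  have u: "u \<in> points P" "y \<le> u" "pos P p \<le> u" "u < x"
    using y pN \<open>y < x\<close> pos_in_points[of p] by (auto simp: u_def max_def)
  have ThetaL: "Theta_L P u sp \<le> Theta P y s + d / C"
  proof (cases "u = pos P p")
    case True
    have "Theta_L P u sp \<le> Theta_L P u (\<lambda>_. 0)"
      using Wsp0 True pos_less_iff[OF _ pN(1)] by (intro Theta_L_compare0 u) (auto simp: W_def)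
    also have "\<dots> \<le> 0" by (intro Theta_L_le) (auto simp: g_def W_def)
    also have "0 \<le> Theta P y s + d / C"
      using Theta_nonneg[OF y(1), of s] \<open>0 \<le> d\<close> C by simp
    finally show ?thesis .
  next
    case False
    then have "u = y" by (auto simp: u_def max_def)
    have "Theta_L P u sp \<le> Theta_L P u s + d / C"
    proof (rule Theta_L_compare[OF u(1) \<open>0 \<le> d\<close> C])
      fix i assume i: "i \<le> N" "pos P i < u" "0 < W sp 0 i"
      then have "p \<le> i" using Wsp0[of i] by (cases "i < p") auto
      moreover have "C \<le> cap_between P (pos P i) u" unfolding C_def
        using i u x pN \<open>p \<le> i\<close> pos_in_points pos_le_iff by (intro cap_between_antimono) auto
      ultimately show "0 < W s 0 i \<and> W sp 0 i \<le> W s 0 i + d \<and> C \<le> cap_between P (pos P i) u"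
        using Wsp[of i] Ws[of i] s(2) i by simp
    qed
    then show ?thesis using \<open>u = y\<close> by (simp add: Theta_def)
  qed
  have "Theta_R P u sp \<le> Theta_R P u s"
  proof (rule Theta_R_compare0[OF u(1)])
    fix i assume i: "i \<le> N" "u < pos P i"
    then have "p < i" using u pN pos_less_iff[of p i] by auto
    then show "W sp i N \<le> W s i N" using Wsp_le[of "i - 1" N] by simp
  qed
  also have "Theta_R P u s \<le> Theta_R P y s" using u y by (intro Theta_R_antimono)
  also have "\<dots> \<le> Theta P y s" by (simp add: Theta_def)
  finally have ThetaR: "Theta_R P u sp \<le> Theta P y s" .
  \<comment> \<open>Replacing \<open>l\<close> by the earlier \<open>p\<close> lengthens the
    distance and does not raise the capacity. Adding \<open>d / C\<close> then gives exactly
    \<open>g\<close> at \<open>p\<close> for \<open>sp\<close>.\<close>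
  have "Theta P x s \<le> (x - pos P p) + W s 0 l / C"
  proof -
    have "C \<le> cap_between P (pos P l) x" unfolding C_def
      using pN lN x pos_in_points by (intro cap_between_antimono) auto
    then have "W s 0 l / cap_between P (pos P l) x \<le> W s 0 l / C"
      using s(2) C by (intro divide_left_mono) auto
    then show ?thesis using left s(2) pN by (simp add: g_def)
  qed
  also have "\<dots> + d / C = g P sp x p"
    using Wp s(2,3) by (simp add: g_def C_def[symmetric] d_def diff_divide_distrib)
  finally have gp: "Theta P x s + d / C \<le> g P sp x p" by simp
  have "Theta_OPT P sp \<le> Theta P u sp" using u by (intro Theta_OPT_le)
  moreover have "Theta P u sp \<le> Theta P y s + d / C"
    using ThetaL ThetaR \<open>0 \<le> d\<close> C by (auto simp: Theta_def intro: order_trans[of _ "Theta P y s"])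
  moreover have "g P sp x p \<le> Theta P x sp"
    using Theta_L_ge[OF pN(4), of sp] by (simp add: Theta_def)
  ultimately show ?thesis using gp y(2) unfolding sp_def[symmetric] regret_def by linarith
qed

text \<open>If some lower bound up to \<open>l\<close> is positive, the weight is bounded away from
  0 and compactness suffices. If all upper bounds vanish, so does \<open>g\<close>. Otherwise
  \<open>p\<close> is the last vertex up to \<open>l\<close> with positive upper bound, and
  \<open>wu p\<close> is the threshold between large and small weights.\<close>

lemma left_vertex_dominated:
  assumes x: "x \<in> points P" and l: "l \<in> left_vertices P x"
  shows "\<exists>s0\<in>S. \<forall>s\<in>S. Theta P x s = g P s x l \<longrightarrow> regret P x s \<le> regret P x s0"
proof -
  have lN: "l \<le> N" using l by (simp add: left_vertices_def)
  have triv: "regret P x s \<le> regret P x s0"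
    if "Theta P x s = g P s x l" "\<not> 0 < W s 0 l \<or> \<not> 0 < regret P x s" for s s0
    using that regret_nonneg[OF x, of s0] Theta_OPT_nonneg[of s] by (auto simp: regret_def g_def)
  show ?thesis
  proof (cases "\<forall>t\<le>l. wl t = 0")
    case False
    then obtain t where "t \<le> l" "0 < wl t" using wl_bounds(1) lN by (metis le_trans less_eq_real_def)
    then have "0 < W wl 0 l" using W_ge[of wl 0 t l] lN wl_bounds by (auto simp: nonneg_def)
    then show ?thesis using large_dominated[OF x l] W_ge_wl[OF _ lN, of _ 0] by blast
  next
    case True
    show ?thesis
    proof (cases "\<forall>t\<le>l. wu t = 0")
      case True
      then have "W wu 0 l = 0" unfolding W_def by (intro sum.neutral) auto
      then show ?thesis using low_in_S triv W_le_wu[OF _ lN, of _ 0] by fastforce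
    next
      case False
      define p where "p = Max {t. t \<le> l \<and> wu t \<noteq> 0}"
      have fin: "finite {t. t \<le> l \<and> wu t \<noteq> 0}" by simp
      moreover have "{t. t \<le> l \<and> wu t \<noteq> 0} \<noteq> {}" using False by auto
      ultimately have "p \<in> {t. t \<le> l \<and> wu t \<noteq> 0}" unfolding p_def by (rule Max_in)
      then have p: "p \<le> l" "wu p \<noteq> 0" by auto
      have pmax: "wu t = 0" if "p < t" "t \<le> l" for t
      proof (rule ccontr)
        assume "wu t \<noteq> 0"
        then have "t \<le> p" unfolding p_def using fin that by (intro Max_ge) auto
        then show False using that by simp
      qed
      have "0 < wu p" using p wl_bounds[of p] lN by auto
      define sp where "sp = restrict (wl(p := wu p)) {..N}"
      have "sp \<in> S" unfolding sp_def by (rule S_I) (auto simp: wl_bounds)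
      obtain s0 where s0: "s0 \<in> S"
        "\<And>s. s \<in> S \<Longrightarrow> wu p \<le> W s 0 l \<Longrightarrow> Theta P x s = g P s x l \<Longrightarrow> regret P x s \<le> regret P x s0"
        using large_dominated[OF x l \<open>0 < wu p\<close>] by blast
      define s1 where "s1 = (if regret P x sp \<le> regret P x s0 then s0 else sp)"
      have s1: "regret P x sp \<le> regret P x s1" "regret P x s0 \<le> regret P x s1" "s1 \<in> S"
        using \<open>sp \<in> S\<close> s0(1) by (auto simp: s1_def)
      have "regret P x s \<le> regret P x s1" if "s \<in> S" "Theta P x s = g P s x l" for s
      proof (cases "0 < W s 0 l \<and> 0 < regret P x s")
        case True
        then show ?thesis
          using s0(2)[of s] small_dominated[OF x l _ p(1) pmax that(1), folded sp_def]
            \<open>\<forall>t\<le>l. wl t = 0\<close> that s1 by (cases "wu p \<le> W s 0 l") auto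
      qed (use triv that in blast)
      then show ?thesis using s1(3) by blast
    qed
  qed
qed

text \<open>Only finitely many vertices can be the maximizer, so the best of their dominating
  scenarios serves for all.\<close>

lemma left_dominated:
  assumes x: "x \<in> points P"
  shows "\<exists>s0\<in>S. \<forall>s\<in>S. Theta P x s = Theta_L P x s \<longrightarrow> regret P x s \<le> regret P x s0"
proof (cases "left_vertices P x = {}")
  case True
  have "regret P x s \<le> regret P x (restrict wl {..N})" if "Theta P x s = Theta_L P x s" for s
    using that True regret_nonneg[OF x, of "restrict wl {..N}"] Theta_OPT_nonneg[of s]
    by (simp add: regret_def Theta_L_def)
  then show ?thesis using low_in_S by blast
next
  case False
  obtain c where c: "\<And>l. l \<in> left_vertices P x \<Longrightarrow> c l \<in> S"
    "\<And>l s. l \<in> left_vertices P x \<Longrightarrow> s \<in> S \<Longrightarrow> Theta P x s = g P s x l \<Longrightarrow> regret P x s \<le> regret P x (c l)"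
    using left_vertex_dominated[OF x] by metis
  define M where "M = Max ((\<lambda>l. regret P x (c l)) ` left_vertices P x)"
  have "M \<in> (\<lambda>l. regret P x (c l)) ` left_vertices P x"
    unfolding M_def using False by (intro Max_in) auto
  then obtain k where k: "k \<in> left_vertices P x" "M = regret P x (c k)" by blast
  have "regret P x s \<le> regret P x (c k)" if s: "s \<in> S" "Theta P x s = Theta_L P x s" for s
  proof -
    obtain l where l: "l \<in> left_vertices P x" "Theta_L P x s = g P s x l"
      using Theta_L_attained[OF False] .
    then have "regret P x s \<le> regret P x (c l)" using c(2) s by simp
    also have "\<dots> \<le> M" unfolding M_def using l by (intro Max_ge) auto
    finally show ?thesis using k by simp
  qed
  then show ?thesis using c(1) k by blast
qed

section \<open>Transfer to the right side by reflection\<close>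

lemma S_ij_D:
  assumes "s \<in> S_ij P wl wu i j" "t \<le> N"
  shows "t < i \<or> j < t \<Longrightarrow> s t = wl t" "i < t \<Longrightarrow> t < j \<Longrightarrow> s t = wu t"
  using assms by (auto simp: S_ij_def s_ij_def)

abbreviation (input) mP :: path_network where "mP \<equiv> mirror P"
abbreviation (input) m :: "scenario \<Rightarrow> scenario" where "m \<equiv> mirror_w P"

lemma network_intervals_mirror: "network_intervals mP (m wl) (m wu)"
proof -
  interpret M: network mP by (rule network_mirror)
  show ?thesis by unfold_locales (auto simp: weight_intervals_def mirror_w_def wl_bounds)
qed

lemma S_mirror: "s \<in> S \<Longrightarrow> m s \<in> scenarios mP (m wl) (m wu)"
  by (auto simp: scenarios_def mirror_w_def PiE_def Pi_def)

lemma S_of_mirror: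
  assumes "s \<in> scenarios mP (m wl) (m wu)"
  shows "m s \<in> S" "m (m s) = s"
proof -
  have b: "m wl t \<le> s t \<and> s t \<le> m wu t" if "t \<le> N" for t
    using assms that by (auto simp: scenarios_def PiE_def Pi_def)
  show "m s \<in> S"
    unfolding mirror_w_def
  proof (rule S_I)
    show "wl t \<le> s (N - t) \<and> s (N - t) \<le> wu t" if "t \<le> N" for t
      using b[of "N - t"] that by (simp add: mirror_w_def)
  qed
  show "m (m s) = s"
  proof
    show "m (m s) t = s t" for t
      using assms by (auto simp: mirror_w_def scenarios_def PiE_def extensional_def)
  qed
qed

lemma right_dominated:
  assumes x: "x \<in> points P"
  shows "\<exists>s0\<in>S. \<forall>s\<in>S. Theta P x s = Theta_R P x s \<longrightarrow> regret P x s \<le> regret P x s0"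
proof -
  obtain s0 where s0: "s0 \<in> scenarios mP (m wl) (m wu)"
    "\<And>s. s \<in> scenarios mP (m wl) (m wu) \<Longrightarrow> Theta mP (L - x) s = Theta_L mP (L - x) s \<Longrightarrow>
      regret mP (L - x) s \<le> regret mP (L - x) s0"
    using network_intervals.left_dominated[OF network_intervals_mirror, of "L - x"] x by auto
  have "regret P x s \<le> regret P x (m s0)" if "s \<in> S" "Theta P x s = Theta_R P x s" for s
    using s0(2)[OF S_mirror[OF that(1)]] that(2) x regret_mirror[OF x, of s]
      regret_mirror[OF x, of "m s0"] S_of_mirror(2)[OF s0(1)]
    by (simp add: Theta_mirror Theta_L_mirror)
  then show ?thesis using S_of_mirror(1)[OF s0(1)] by blast
qed

lemma worst_case_exists:
  assumes x: "x \<in> points P"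
  obtains s where "s \<in> S" "\<forall>s'\<in>S. regret P x s' \<le> regret P x s"
proof -
  obtain sl where sl: "sl \<in> S" "\<And>s. s \<in> S \<Longrightarrow> Theta P x s = Theta_L P x s \<Longrightarrow> regret P x s \<le> regret P x sl"
    using left_dominated[OF x] by blast
  obtain sr where sr: "sr \<in> S" "\<And>s. s \<in> S \<Longrightarrow> Theta P x s = Theta_R P x s \<Longrightarrow> regret P x s \<le> regret P x sr"
    using right_dominated[OF x] by blast
  have "Theta P x s = Theta_L P x s \<or> Theta P x s = Theta_R P x s" for s
    by (auto simp: Theta_def max_def)
  then have le: "regret P x s \<le> max (regret P x sl) (regret P x sr)" if "s \<in> S" for s
    using sl(2) sr(2) that by (meson le_max_iff_disj)
  show thesis
  proof (cases "regret P x sl \<le> regret P x sr")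
    case True
    then show ?thesis using le sr(1) that[of sr] by (simp add: max_def)
  next
    case False
    then show ?thesis using le sl(1) that[of sl] by (simp add: max_def)
  qed
qed

lemma right_worst_case:
  assumes x: "x \<in> points P" and s: "s \<in> S" and max: "\<forall>s'\<in>S. regret P x s' \<le> regret P x s"
    and pos: "0 < regret P x s" and right: "Theta P x s = Theta_R P x s"
  obtains i j s' where "i \<le> j" "j \<le> N" "worst_case P wl wu x s'" "s' \<in> S_ij P wl wu i j"
    "Theta P x s' = Theta_R P x s'"
    "(RCV P x s' = Some i \<and> x \<le> x_OPT P s' \<and> x_OPT P s' \<le> pos P i \<and> x < pos P i \<and>
       (i = j \<or> i < j \<and> s' i = wu i)) \<or>
     ((\<exists>r. RCV P x s' = Some r \<and> r \<le> i) \<and>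
       x \<le> pos P i \<and> pos P i \<le> x_OPT P s' \<and> x_OPT P s' \<le> pos P j)"
proof -
  interpret M: network_intervals mP "m wl" "m wu" by (rule network_intervals_mirror)
  have maxM: "regret mP (L - x) s' \<le> regret mP (L - x) (m s)"
    if "s' \<in> scenarios mP (m wl) (m wu)" for s'
    using bspec[OF max S_of_mirror(1)[OF that]] S_of_mirror(2)[OF that]
      regret_mirror[OF x, of s] regret_mirror[OF x, of "m s'"] by simp
  obtain i j s' where M: "i \<le> j" "j \<le> N" "worst_case mP (m wl) (m wu) (L - x) s'"
    "s' \<in> S_ij mP (m wl) (m wu) i j" "Theta mP (L - x) s' = Theta_L mP (L - x) s'"
    "\<exists>t\<le>N. 0 < s' t"
    "(LCV mP (L - x) s' = Some j \<and> pos mP j \<le> x_OPT mP s' \<and> x_OPT mP s' \<le> L - x \<and>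
       pos mP j < L - x \<and> (i = j \<or> i < j \<and> s' j = m wu j)) \<or>
     ((\<exists>l. LCV mP (L - x) s' = Some l \<and> l \<ge> j) \<and>
       pos mP i \<le> x_OPT mP s' \<and> x_OPT mP s' \<le> pos mP j \<and> pos mP j \<le> L - x)"
  proof (rule M.left_worst_case[of "L - x" "m s"])
    show "L - x \<in> points mP" using x by simp
    show "m s \<in> scenarios mP (m wl) (m wu)" using s by (rule S_mirror)
    show "\<forall>s'\<in>scenarios mP (m wl) (m wu). regret mP (L - x) s' \<le> regret mP (L - x) (m s)"
      using maxM by blast
    show "0 < regret mP (L - x) (m s)" using pos regret_mirror[OF x, of s] by simp
    show "Theta mP (L - x) (m s) = Theta_L mP (L - x) (m s)"
      using right x by (simp add: Theta_mirror Theta_L_mirror)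
  qed (use that in auto)
  define y where "y = x_OPT mP s'"
  have s'S: "s' \<in> scenarios mP (m wl) (m wu)" using M(3) by (simp add: worst_case_def)
  define s2 where "s2 = m s'"
  have s2: "s2 \<in> S" "m s2 = s'" using S_of_mirror[OF s'S] by (simp_all add: s2_def)
  have s2_apply: "s2 t = s' (N - t)" if "t \<le> N" for t using that by (simp add: s2_def mirror_w_def)
  have wc: "worst_case P wl wu x s2"
  proof -
    have "regret P x s'' \<le> regret P x s2" if "s'' \<in> S" for s''
    proof -
      have "regret mP (L - x) (m s'') \<le> regret mP (L - x) (m s2)"
        using M(3) S_mirror[OF that] x s2 by (simp add: M.worst_case_iff)
      then show ?thesis using regret_mirror[OF x, of s''] regret_mirror[OF x, of s2] by simp
    qed
    then show ?thesis using s2 x by (simp add: worst_case_iff)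
  qed
  \<comment> \<open>Reflection reverses the order, so the index pair \<open>i, j\<close> becomes
    \<open>N - j, N - i\<close>.\<close>
  have sij: "s2 \<in> S_ij P wl wu (N - j) (N - i)"
  proof (rule S_ij_I[OF s2(1)])
    show "s2 t = wl t" if "t \<le> N" "t < N - j \<or> N - i < t" for t
      using M.S_ij_D(1)[OF M(4), of "N - t"] that by (simp add: s2_apply mirror_w_def) arith
    show "s2 t = wu t" if "N - j < t" "t < N - i" for t
      using M.S_ij_D(2)[OF M(4), of "N - t"] that by (auto simp: s2_apply mirror_w_def)
  qed (use M(1,2) in auto)
  obtain t where t: "t \<le> N" "0 < s' t" using M(6) by blast
  have y: "y \<in> points P" "Theta mP y s' = Theta_OPT mP s'" using M.x_OPT[of s'] by (auto simp: y_def)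
  \<comment> \<open>\<open>x_OPT\<close> is an arbitrary choice among minimizers and commutes with
    reflection only where the minimizer is unique, which the positive weight at \<open>t\<close>
    guarantees.\<close>
  have xo: "x_OPT P s2 = L - y"
  proof (rule x_OPT_unique[of s2 "N - t"])
    show "Theta P (L - y) s2 = Theta_OPT P s2"
      using Theta_mirror[of "L - y" s2] Theta_OPT_mirror[of s2] y s2 by simp
  qed (use s2_apply[of "N - t"] t y S_nonneg[OF s2(1)] in auto)
  have R: "RCV P x s2 = map_option (\<lambda>l. N - l) (LCV mP (L - x) s')"
    using RCV_mirror[OF x, of s2] s2 by simp
  have pm: "pos mP j = L - pos P (N - j)" "pos mP i = L - pos P (N - i)" by (simp_all add: pos_mirror)
  have wj: "m wu j = wu (N - j)" using M(2) by (simp add: mirror_w_def)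
  show thesis
  proof (rule that[of "N - j" "N - i" s2])
    show "Theta P x s2 = Theta_R P x s2"
      using M(5) Theta_mirror[OF x, of s2] Theta_L_mirror[OF x, of s2] s2 by simp
    show "(RCV P x s2 = Some (N - j) \<and> x \<le> x_OPT P s2 \<and> x_OPT P s2 \<le> pos P (N - j) \<and> x < pos P (N - j) \<and>
         (N - j = N - i \<or> N - j < N - i \<and> s2 (N - j) = wu (N - j))) \<or>
      ((\<exists>r. RCV P x s2 = Some r \<and> r \<le> N - j) \<and> x \<le> pos P (N - j) \<and> pos P (N - j) \<le> x_OPT P s2 \<and>
         x_OPT P s2 \<le> pos P (N - i))"
      using M(7)[folded y_def]
    proof (elim disjE)
      assume "LCV mP (L - x) s' = Some j \<and> pos mP j \<le> y \<and> y \<le> L - x \<and> pos mP j < L - x \<and>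
        (i = j \<or> i < j \<and> s' j = m wu j)"
      then show ?thesis using R pm wj s2_apply[of "N - j"] M(1,2) xo by (simp, linarith)
    next
      assume "(\<exists>l. LCV mP (L - x) s' = Some l \<and> l \<ge> j) \<and> pos mP i \<le> y \<and> y \<le> pos mP j \<and> pos mP j \<le> L - x"
      then show ?thesis using R pm xo by auto
    qed
  qed (use wc sij M(1,2) in auto)
qed

section \<open>The case of zero maximal regret\<close>

lemma RCV_exists:
  assumes "x \<in> points P" "right_vertices P x \<noteq> {}"
  obtains r where "RCV P x s = Some r" "r \<in> right_vertices P x"
proof -
  have "left_vertices mP (L - x) \<noteq> {}" using assms by (simp add: left_vertices_mirror)
  then obtain l where l: "LCV mP (L - x) (m s) = Some l"
    using network.LCV_exists[OF network_mirror] by blast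
  then have "l \<in> left_vertices mP (L - x)"
    using network.LCV_iff[OF network_mirror] by blast
  then obtain r where "l = N - r" "r \<in> right_vertices P x" by (auto simp: left_vertices_mirror)
  then have "N - l \<in> right_vertices P x" by (simp add: right_vertices_def)
  then show thesis using that[of "N - l"] l RCV_mirror[OF assms(1), of s] by simp
qed

text \<open>Every scenario is a worst case here, in particular that of lower bounds. If it has
  positive weight, \<open>x\<close> is its unique optimum and the critical vertex alone serves as
  \<open>i = j\<close>. If it is zero, \<open>x_OPT\<close> is unspecified and every possible
  position has to be covered.\<close>

lemma zero_regret_case:
  assumes x: "x \<in> points P" and zero: "\<And>s. s \<in> S \<Longrightarrow> regret P x s = 0"
  shows "\<exists>i j s.
    i \<le> j \<and> j \<le> N \<and> worst_case P wl wu x s \<and> s \<in> S_ij P wl wu i j \<and>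
    ((Theta P x s = Theta_L P x s \<and>
      ((LCV P x s = Some j \<and> pos P j \<le> x_OPT P s \<and> x_OPT P s \<le> x \<and> pos P j < x \<and>
        (i = j \<or> (i < j \<and> s j = wu j))) \<or>
       ((\<exists>l. LCV P x s = Some l \<and> l \<ge> j) \<and>
        pos P i \<le> x_OPT P s \<and> x_OPT P s \<le> pos P j \<and> pos P j \<le> x))) \<or>
     (Theta P x s = Theta_R P x s \<and>
      ((RCV P x s = Some i \<and> x \<le> x_OPT P s \<and> x_OPT P s \<le> pos P i \<and> x < pos P i \<and>
        (i = j \<or> (i < j \<and> s i = wu i))) \<or>
       ((\<exists>r. RCV P x s = Some r \<and> r \<le> i) \<and>
        x \<le> pos P i \<and> pos P i \<le> x_OPT P s \<and> x_OPT P s \<le> pos P j))))"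
proof -
  define s where "s = restrict wl {..N}"
  have s: "s \<in> S" unfolding s_def by (rule low_in_S)
  have wc: "worst_case P wl wu x s" using zero s x by (simp add: worst_case_iff)
  have s_ii: "s \<in> S_ij P wl wu i i" if "i \<le> N" for i
    by (rule S_ij_I[OF s]) (use that in \<open>auto simp: s_def\<close>)
  have Theta_x: "Theta P x s' = Theta_OPT P s'" if "s' \<in> S" for s'
    using zero[OF that] by (simp add: regret_def)
  define o' where "o' = x_OPT P s"
  have o': "o' \<in> points P" unfolding o'_def by (rule x_OPT)
  have "pos P 0 < pos P N" using network pos_less[of 0 N] by (simp add: path_network_def)
  then have sides: "left_vertices P x = {} \<Longrightarrow> x = pos P 0 \<and> right_vertices P x \<noteq> {}"
    "right_vertices P x = {} \<Longrightarrow> x = L \<and> left_vertices P x \<noteq> {}"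
    using x by (force simp: left_vertices_def right_vertices_def points_def)+
  show ?thesis
  proof (cases "\<exists>t\<le>N. 0 < wl t")
    case True
    then have ox: "x_OPT P s = x"
      using x_OPT_unique[OF S_nonneg[OF s] _ _ x Theta_x[OF s]] by (auto simp: s_def)
    show ?thesis
    proof (cases "left_vertices P x \<noteq> {} \<and> Theta_R P x s \<le> Theta_L P x s")
      case True
      then obtain l where l: "LCV P x s = Some l" using LCV_exists by blast
      then have "l \<in> left_vertices P x" by (simp add: LCV_iff)
      then have "l \<le> N" "pos P l < x" by (auto simp: left_vertices_def)
      moreover have "Theta P x s = Theta_L P x s" using True by (simp add: Theta_def)
      ultimately show ?thesis
        using l ox wc s_ii by (intro exI[of _ l] exI[of _ s]) auto
    next
      case False
      have "right_vertices P x \<noteq> {}"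
      proof
        assume "right_vertices P x = {}"
        then show False using False sides(2) Theta_L_nonneg[OF x, of s] by (simp add: Theta_R_def)
      qed
      then obtain r where r: "RCV P x s = Some r" "r \<in> right_vertices P x"
        using RCV_exists[OF x] by blast
      then have "r \<le> N" "x < pos P r" by (auto simp: right_vertices_def)
      moreover have "Theta_L P x s \<le> Theta_R P x s"
        using False Theta_R_nonneg[OF x, of s] by (cases "left_vertices P x = {}") (simp add: Theta_L_def, simp)
      then have "Theta P x s = Theta_R P x s" by (simp add: Theta_def)
      ultimately show ?thesis
        using r ox wc s_ii by (intro exI[of _ r] exI[of _ s]) auto
    qed
  next
    case False
    then have wl0: "wl t = 0" if "t \<le> N" for t using wl_bounds(1)[OF that] that by fastforce
    \<comment> \<open>Otherwise the scenario with weight only at \<open>t\<close> has evacuation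
      time 0 at \<open>pos P t\<close> but not at \<open>x\<close>, giving \<open>x\<close> positive
      regret.\<close>
    have wu0: "wu t = 0" if t: "t \<le> N" "pos P t \<noteq> x" for t
    proof (rule ccontr)
      assume "wu t \<noteq> 0"
      then have "0 < wu t" using wl_bounds[OF t(1)] by simp
      define s1 where "s1 = restrict (wl(t := wu t)) {..N}"
      have s1: "s1 \<in> S" unfolding s1_def by (rule S_I) (auto simp: wl_bounds)
      have W0: "W s1 i j = 0" if "t \<notin> {i..j}" "j \<le> N" for i j
        unfolding W_def using that wl0 by (intro sum.neutral) (auto simp: s1_def)
      have Wz: "W (\<lambda>_. 0) i j = 0" for i j by (simp add: W_def)
      have "Theta_L P (pos P t) s1 \<le> 0"
        using t by (intro Theta_L_le) (auto simp: left_vertices_def g_def W0 pos_less_iff)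
      moreover have "Theta_R P (pos P t) s1 \<le> Theta_R P (pos P t) (\<lambda>_. 0)"
        using t by (intro Theta_R_compare0 pos_in_points) (auto simp: W0 Wz pos_less_iff)
      moreover have "Theta_R P (pos P t) (\<lambda>_. 0) = 0"
        by (auto simp: Theta_R_def h_def W_def image_constant_conv)
      ultimately have "Theta P (pos P t) s1 \<le> 0" by (simp add: Theta_def)
      then have "Theta P x s1 = 0"
        using Theta_x[OF s1] Theta_OPT_le[OF pos_in_points[OF t(1)], of s1] Theta_nonneg[OF x, of s1] by simp
      then show False
        using Theta_eq_0_pos[OF S_nonneg[OF s1] x, of t] t \<open>0 < wu t\<close> by (simp add: s1_def)
    qed
    have "W s i j = 0" if "j \<le> N" for i j
      unfolding W_def using that wl0 by (intro sum.neutral) (auto simp: s_def)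
    then have L0: "Theta_L P x s = 0" and R0: "Theta_R P x s = 0"
      by (auto simp: Theta_L_def Theta_R_def g_def h_def left_vertices_def image_constant_conv)
    then have T0: "Theta P x s = Theta_L P x s" "Theta P x s = Theta_R P x s" by (simp_all add: Theta_def)
    \<comment> \<open>The zero scenario satisfies both \<open>Theta\<close> equations, so the side
      is chosen by the position of \<open>o'\<close>. At an end of the path with no vertex on that
      side, \<open>o' = x\<close> and the other side serves.\<close>
    have "left_vertices P x \<noteq> {} \<and> o' \<le> x \<or> right_vertices P x \<noteq> {} \<and> x \<le> o'"
      using sides o' by (cases "o' \<le> x") (auto simp: points_def)
    then show ?thesis
    proof (elim disjE conjE)
      assume "left_vertices P x \<noteq> {}" and ox: "o' \<le> x"
      then obtain l where l: "LCV P x s = Some l" using LCV_exists by blast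
      then have "l \<in> left_vertices P x" by (simp add: LCV_iff)
      then have lN: "l \<le> N" "pos P l < x" by (auto simp: left_vertices_def)
      show ?thesis
      proof (cases "pos P l \<le> o'")
        case True
        then show ?thesis using l lN ox wc s_ii T0
          by (intro exI[of _ l] exI[of _ s]) (auto simp: o'_def)
      next
        case False
        \<comment> \<open>Upper bounds vanish left of \<open>x\<close>, so the zero scenario also
          lies in \<open>S_ij\<close> for the whole range \<open>0, ..., l\<close>, which encloses
          \<open>o'\<close>.\<close>
        have "pos P t < x" if "t < l" for t using that lN pos_less[of t l] by simp
        then have "s \<in> S_ij P wl wu 0 l"
          using lN by (intro S_ij_I[OF s]) (auto simp: s_def wl0 wu0 less_imp_neq)
        moreover have "pos P 0 \<le> o'" using o' by (simp add: points_def)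
        ultimately show ?thesis using l lN wc T0 False
          by (intro exI[of _ 0] exI[of _ l] exI[of _ s]) (auto simp: o'_def)
      qed
    next
      assume "right_vertices P x \<noteq> {}" and ox: "x \<le> o'"
      then obtain r where r: "RCV P x s = Some r" "r \<in> right_vertices P x"
        using RCV_exists[OF x] by blast
      then have rN: "r \<le> N" "x < pos P r" by (auto simp: right_vertices_def)
      show ?thesis
      proof (cases "o' \<le> pos P r")
        case True
        then show ?thesis using r rN ox wc s_ii T0
          by (intro exI[of _ r] exI[of _ s]) (auto simp: o'_def)
      next
        case False
        have "x < pos P t" if "r < t" "t \<le> N" for t using that rN pos_less[of r t] by simp
        then have "s \<in> S_ij P wl wu r N"
          using rN by (intro S_ij_I[OF s]) (auto simp: s_def wl0 wu0 less_imp_neq[symmetric])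
        moreover have "o' \<le> L" using o' by (simp add: points_def)
        ultimately show ?thesis using r rN wc T0 False
          by (intro exI[of _ r] exI[of _ N] exI[of _ s]) (auto simp: o'_def)
      qed
    qed
  qed
qed

end

theorem theorem2:
  fixes P :: path_network and wl wu :: "nat \<Rightarrow> real" and x :: real
  assumes "path_network P"
    and "weight_intervals P wl wu"
    and "x \<in> points P"
  shows "\<exists>i j s.
    i \<le> j \<and> j \<le> last_vertex P \<and>
    worst_case P wl wu x s \<and> s \<in> S_ij P wl wu i j \<and>
    ((Theta P x s = Theta_L P x s \<and>
      ((LCV P x s = Some j \<and>
        pos P j \<le> x_OPT P s \<and> x_OPT P s \<le> x \<and> pos P j < x \<and>
        (i = j \<or> (i < j \<and> s j = wu j)))
       \<or>
       ((\<exists>l. LCV P x s = Some l \<and> l \<ge> j) \<and>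
        pos P i \<le> x_OPT P s \<and> x_OPT P s \<le> pos P j \<and> pos P j \<le> x)))
     \<or>
     (Theta P x s = Theta_R P x s \<and>
      ((RCV P x s = Some i \<and>
        x \<le> x_OPT P s \<and> x_OPT P s \<le> pos P i \<and> x < pos P i \<and>
        (i = j \<or> (i < j \<and> s i = wu i)))
       \<or>
       ((\<exists>r. RCV P x s = Some r \<and> r \<le> i) \<and>
        x \<le> pos P i \<and> pos P i \<le> x_OPT P s \<and> x_OPT P s \<le> pos P j))))"
proof -
  interpret network_intervals P wl wu
    by unfold_locales (fact assms)+
  note x = \<open>x \<in> points P\<close>
  obtain s where s: "s \<in> S" "\<forall>s'\<in>S. regret P x s' \<le> regret P x s"
    using worst_case_exists[OF x] by blast
  show ?thesis
  proof (cases "0 < regret P x s")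
    case False
    then have "regret P x s' = 0" if "s' \<in> S" for s'
      using bspec[OF s(2) that] regret_nonneg[OF x, of s'] by simp
    then show ?thesis using zero_regret_case[OF x] by blast
  next
    case pos: True
    show ?thesis
    proof (cases "Theta P x s = Theta_L P x s")
      case True
      show ?thesis
      proof (rule left_worst_case[OF x s pos True], goal_cases)
        case (1 i j s')
        then show ?case by (intro exI[of _ i] exI[of _ j] exI[of _ s']) simp
      qed
    next
      case False
      then have "Theta P x s = Theta_R P x s" by (simp add: Theta_def max_def split: if_splits)
      then show ?thesis
      proof (rule right_worst_case[OF x s pos], goal_cases)
        case (1 i j s')
        then show ?case by (intro exI[of _ i] exI[of _ j] exI[of _ s']) simp
      qed
    qed
  qed
qed

end
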